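(* Let $(\Omega,\{\mathcal F_t\}_{t\ge 0})$ be a filtered sample space carrying two probability measures $P$ and $Q$ such that $P$ is absolutely continuous with respect to $Q$ on every $\mathcal F_t$. Let $h_t$ denote the Radon-Nikodým process $dP/dQ$ on $\mathcal F_t$, let $\tau_0=\inf\{s>0:\ h_s=0\}$, and assume $Q(\tau_0<\infty)>0$. Assume that $h$ is a continuous process $Q$-almost surely. Let $\{f_t,\ t\ge 0\}$ be a continuous $Q$-martingale adapted to $\{\mathcal F_t\}$, and let $\sigma_0=\inf\{s\ge 0:\ f_s=0\}$. Suppose that either of the following two conditions holds: (i) $f$ is uniformly integrable (under $Q$), $E^Q(f_0)\ne 0$, and $Q(\tau_0<\infty)=1$; or (ii) $f$ is nonnegative and $Q(\sigma_0>\tau_0)>0$. Then the process $N_t:=f_t/h_t$ is a strict local martingale under $P$. However, if $f$ is nonnegative and $Q(\sigma_0>\tau_0)=0$, then the process $N_t$ is a martingale under $P$.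
   Context: A strict local martingale is a local martingale which is not a martingale. $E^Q$ denotes expectation under $Q$. Infima of empty sets are $+\infty$. The process $N_t=f_t/h_t$ is considered under $P$, under which $h$ is almost surely strictly positive at all times.
   Formalization: The strict local martingale claim additionally assumes h_0 > 0 Q-almost surely (it fails otherwise), and almost sure continuity of h and f means that for each T the exceptional set of paths discontinuous on [0,T] lies in a Q-null set of F_T. *)

theory Defs
  imports "HOL-Probability.Probability"
begin

text \<open>
  Time is [0,\<infinity>), embedded in the reals. Filtrations are indexed by all reals because the
  library's locale and its stopping times quantify over a whole index type; the definitions below
  only look at nonnegative times, and a filtration on [0,\<infinity>) extends by F t = F 0 for t < 0.
  Filtrations are not assumed complete or right-continuous. Enlarging F 0 by all Q-null sets would
  turn local absolute continuity of P with respect to Q into absolute continuity on the whole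
  sigma-algebra generated by the filtration.
\<close>

definition martingale ::
  "'a measure \<Rightarrow> (real \<Rightarrow> 'a measure) \<Rightarrow> (real \<Rightarrow> 'a \<Rightarrow> real) \<Rightarrow> bool" where
  "martingale M F X \<longleftrightarrow>
     (\<forall>t\<ge>0. X t \<in> borel_measurable (F t) \<and> integrable M (X t)) \<and>
     (\<forall>s\<ge>0. \<forall>t\<ge>s. AE \<omega> in M. real_cond_exp M (F s) (X t) \<omega> = X s \<omega>)"

text \<open>
  The localizing times are finite, so that the library's stopping times apply; replacing T n by
  the minimum of T n and n shows that nothing is lost. The stopped process is required to be
  indistinguishable from a martingale Y n rather than to be one itself: in a filtration that need
  not be complete, stopping a process whose paths are only almost surely continuous can destroy
  measurability on a null set.
\<close>

definition local_martingale ::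
  "'a measure \<Rightarrow> (real \<Rightarrow> 'a measure) \<Rightarrow> (real \<Rightarrow> 'a \<Rightarrow> real) \<Rightarrow> bool" where
  "local_martingale M F X \<longleftrightarrow>
     (\<forall>t\<ge>0. X t \<in> borel_measurable (F t)) \<and>
     (\<exists>T :: nat \<Rightarrow> 'a \<Rightarrow> real.
        (\<forall>n. stopping_time F (T n) \<and> (\<forall>\<omega>\<in>space M. 0 \<le> T n \<omega>)) \<and>
        (AE \<omega> in M. incseq (\<lambda>n. T n \<omega>) \<and> filterlim (\<lambda>n. T n \<omega>) at_top sequentially) \<and>
        (\<forall>n. \<exists>Y. martingale M F Y \<and>
              (AE \<omega> in M. \<forall>t\<ge>0. X (min t (T n \<omega>)) \<omega> = Y t \<omega>)))"

definition strict_local_martingale ::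
  "'a measure \<Rightarrow> (real \<Rightarrow> 'a measure) \<Rightarrow> (real \<Rightarrow> 'a \<Rightarrow> real) \<Rightarrow> bool" where
  "strict_local_martingale M F X \<longleftrightarrow> local_martingale M F X \<and> \<not> martingale M F X"

definition uniformly_integrable :: "'a measure \<Rightarrow> (real \<Rightarrow> 'a \<Rightarrow> real) \<Rightarrow> bool" where
  "uniformly_integrable M X \<longleftrightarrow>
     (\<forall>t\<ge>0. integrable M (X t)) \<and>
     (\<forall>\<epsilon>>0. \<exists>K. \<forall>t\<ge>0.
        (\<integral>\<omega>. \<bar>X t \<omega>\<bar> * indicator {\<omega>. K < \<bar>X t \<omega>\<bar>} \<omega> \<partial>M) < \<epsilon>)"

text \<open>
  Almost sure continuity, with the exceptional null set for the horizon T taken in F T. A measure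
  that is only locally absolutely continuous with respect to M can charge M-null sets lying
  outside every F T, so a null set of the ambient sigma-algebra would say nothing about the paths
  under such a measure.
\<close>

definition as_continuous ::
  "'a measure \<Rightarrow> (real \<Rightarrow> 'a measure) \<Rightarrow> (real \<Rightarrow> 'a \<Rightarrow> real) \<Rightarrow> bool" where
  "as_continuous M F X \<longleftrightarrow>
     (\<forall>T\<ge>0. AE \<omega> in restr_to_subalg M (F T). continuous_on {0..T} (\<lambda>t. X t \<omega>))"

definition locally_abs_continuous ::
  "'a measure \<Rightarrow> 'a measure \<Rightarrow> (real \<Rightarrow> 'a measure) \<Rightarrow> bool" where
  "locally_abs_continuous P Q F \<longleftrightarrow>
     (\<forall>t\<ge>0. absolutely_continuous (restr_to_subalg Q (F t)) (restr_to_subalg P (F t)))"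

text \<open>Any adapted version of dP/dQ on F t, t \<ge> 0. Note that RN_deriv Q P is dP/dQ.\<close>

definition RN_process ::
  "'a measure \<Rightarrow> 'a measure \<Rightarrow> (real \<Rightarrow> 'a measure) \<Rightarrow> (real \<Rightarrow> 'a \<Rightarrow> real) \<Rightarrow> bool" where
  "RN_process P Q F h \<longleftrightarrow>
     (\<forall>t\<ge>0. h t \<in> borel_measurable (F t) \<and>
        (AE \<omega> in Q. h t \<omega> =
           enn2real (RN_deriv (restr_to_subalg Q (F t)) (restr_to_subalg P (F t)) \<omega>)))"

text \<open>The two hitting times of zero differ in whether time 0 counts. In ereal, Inf {} = \<infinity>.\<close>

definition pos_hitting_zero :: "(real \<Rightarrow> 'a \<Rightarrow> real) \<Rightarrow> 'a \<Rightarrow> ereal" where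
  "pos_hitting_zero X \<omega> = Inf (ereal ` {s. 0 < s \<and> X s \<omega> = 0})"

definition hitting_zero :: "(real \<Rightarrow> 'a \<Rightarrow> real) \<Rightarrow> 'a \<Rightarrow> ereal" where
  "hitting_zero X \<omega> = Inf (ereal ` {s. 0 \<le> s \<and> X s \<omega> = 0})"

text \<open>
  Positive probability as "not a null event". The library's measure is 0 on nonmeasurable sets, and
  events about hitting times are here only measurable up to null sets; for measurable events this
  is the same as measure M {\<omega> \<in> space M. A \<omega>} > 0.
\<close>

definition pos_prob :: "'a measure \<Rightarrow> ('a \<Rightarrow> bool) \<Rightarrow> bool" where
  "pos_prob M A \<longleftrightarrow> \<not> (AE \<omega> in M. \<not> A \<omega>)"

end

theory Submission
  imports Defs
begin

text \<open>
  For a time t and a set A in F t, changing measure gives E^P[N_t; A] = E^Q[f_t; A, h_t > 0].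
  Stop N when h comes close to 0 or f becomes large. Up to that time N is bounded, and
  this identity together with the martingale property of f makes the stopped process a P-martingale;
  since h is strictly positive under P, these exit times increase to infinity, and N is a local
  martingale. If N were a martingale, the identity with A the whole space would make
  E^Q[f_t; h_t > 0] constant in t. Since h stays at 0 once it has reached 0, this quantity tends to 0
  in case (i), and in case (ii) the mass E^Q[f_t; h_t = 0] is positive for some t. If f reaches 0 no
  later than h, then f vanishes wherever h does, so E^P[N_t; A] = E^Q[f_t; A] and N inherits the
  martingale property.
\<close>

text \<open>The filtration is raw, and this shapes the proof. Paths are continuous only almost
  surely, so a hitting time defined from whole paths need not be a stopping time, and a stopped
  process need not be adapted. Events are therefore phrased through rational times, which puts them
  in \<open>F t\<close> for every path; the exit times come from an event whose set of times is
  closed on the left for every path; and the stopped process is a limit along stopping times with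
  finitely many values. Such times also reduce every integral to a finite sum of identities at fixed
  times, so no general optional stopping theorem enters. Absorption of \<open>h\<close> at zero is
  obtained without stopping at \<tau>_0, from a bound of maximal-inequality type.

  The hypothesis \<open>0 < h 0\<close> Q-almost surely is essential for strictness. Take
  \<open>A\<close> in \<open>F 0\<close> with 0 < Q(A) < 1, h_t = 1_A / Q(A) and f_t = 1: off
  \<open>A\<close> one has \<tau>_0 = 0 < \<sigma>_0, yet N_t equals the constant Q(A) P-almost
  surely and is a martingale.\<close>

section \<open>Martingales through integrals over events\<close>

locale filtered_prob_space = prob_space M + filtration "space M" F
  for M :: "'a measure" and F :: "real \<Rightarrow> 'a measure" +
  assumes subalgebra_F: "\<And>t. 0 \<le> t \<Longrightarrow> subalgebra M (F t)"
begin

lemma sets_F_le: "sets (F t) \<subseteq> sets M"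
proof -
  have "sets (F t) \<subseteq> sets (F (max t 0))"
    by (rule sets_F_mono) simp
  also have "\<dots> \<subseteq> sets M"
    using subalgebra_F[of "max t 0"] by (simp add: subalgebra_def)
  finally show ?thesis .
qed

lemma sets_F_imp: "A \<in> sets (F t) \<Longrightarrow> A \<in> sets M"
  using sets_F_le by blast

lemma measurable_F_mono: "g \<in> measurable (F s) N \<Longrightarrow> s \<le> t \<Longrightarrow> g \<in> measurable (F t) N"
  using sets_F_mono[of s t] by (auto simp: measurable_def space_F)

lemma measurable_F_imp: "g \<in> measurable (F s) N \<Longrightarrow> g \<in> measurable M N"
  using sets_F_le[of s] by (auto simp: measurable_def space_F)

lemma cond_exp_eq_iff:
  assumes "0 \<le> s" "integrable M g" "integrable M k" "k \<in> borel_measurable (F s)"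
  shows "(AE \<omega> in M. real_cond_exp M (F s) g \<omega> = k \<omega>) \<longleftrightarrow>
    (\<forall>A\<in>sets (F s). (\<integral>\<omega>\<in>A. g \<omega> \<partial>M) = (\<integral>\<omega>\<in>A. k \<omega> \<partial>M))"
proof -
  interpret S: finite_measure_subalgebra M "F s"
    by unfold_locales (rule subalgebra_F[OF assms(1)])
  show ?thesis
  proof (intro iffI ballI)
    fix A assume ae: "AE \<omega> in M. real_cond_exp M (F s) g \<omega> = k \<omega>" and A: "A \<in> sets (F s)"
    have AM: "A \<in> sets M" using A by (rule sets_F_imp)
    have "(\<integral>\<omega>\<in>A. g \<omega> \<partial>M) = (\<integral>\<omega>\<in>A. real_cond_exp M (F s) g \<omega> \<partial>M)"
      by (rule S.real_cond_exp_intA[OF assms(2) A])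
    also have "\<dots> = (\<integral>\<omega>\<in>A. k \<omega> \<partial>M)"
      unfolding set_lebesgue_integral_def
      using ae assms AM measurable_F_imp[OF assms(4)] by (intro integral_cong_AE) auto
    finally show "(\<integral>\<omega>\<in>A. g \<omega> \<partial>M) = (\<integral>\<omega>\<in>A. k \<omega> \<partial>M)" .
  next
    assume "\<forall>A\<in>sets (F s). (\<integral>\<omega>\<in>A. g \<omega> \<partial>M) = (\<integral>\<omega>\<in>A. k \<omega> \<partial>M)"
    then show "AE \<omega> in M. real_cond_exp M (F s) g \<omega> = k \<omega>"
      by (intro S.real_cond_exp_charact) (use assms in auto)
  qed
qed

text \<open>A change of measure acts on integrals over events of \<open>F s\<close>, not on
  conditional expectations, so every martingale argument below goes through this form.\<close>

lemma martingale_iff: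
  "martingale M F X \<longleftrightarrow>
    (\<forall>t\<ge>0. X t \<in> borel_measurable (F t) \<and> integrable M (X t)) \<and>
    (\<forall>s\<ge>0. \<forall>t\<ge>s. \<forall>A\<in>sets (F s). (\<integral>\<omega>\<in>A. X t \<omega> \<partial>M) = (\<integral>\<omega>\<in>A. X s \<omega> \<partial>M))"
  unfolding martingale_def
proof (rule conj_cong[OF refl], intro all_cong)
  fix s t :: real
  assume X: "\<forall>t\<ge>0. X t \<in> borel_measurable (F t) \<and> integrable M (X t)" and st: "0 \<le> s" "s \<le> t"
  show "(AE \<omega> in M. real_cond_exp M (F s) (X t) \<omega> = X s \<omega>) \<longleftrightarrow>
    (\<forall>A\<in>sets (F s). (\<integral>\<omega>\<in>A. X t \<omega> \<partial>M) = (\<integral>\<omega>\<in>A. X s \<omega> \<partial>M))"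
    using X st by (intro cond_exp_eq_iff) auto
qed

lemma martingaleD:
  assumes "martingale M F X"
  shows martingale_adapted: "0 \<le> t \<Longrightarrow> X t \<in> borel_measurable (F t)"
    and martingale_integrable: "0 \<le> t \<Longrightarrow> integrable M (X t)"
    and martingale_set_integral:
      "0 \<le> s \<Longrightarrow> s \<le> t \<Longrightarrow> A \<in> sets (F s) \<Longrightarrow> (\<integral>\<omega>\<in>A. X t \<omega> \<partial>M) = (\<integral>\<omega>\<in>A. X s \<omega> \<partial>M)"
  using assms[unfolded martingale_iff] by blast+

lemma martingale_integral_eq:
  assumes "martingale M F X" "0 \<le> s" "s \<le> t"
  shows "(\<integral>\<omega>. X t \<omega> \<partial>M) = (\<integral>\<omega>. X s \<omega> \<partial>M)"
proof -
  have "space M \<in> sets (F s)" by (metis sets.top space_F)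
  from martingale_set_integral[OF assms this] show ?thesis
    using martingale_integrable[OF assms(1)] assms(2,3) by (simp add: set_integral_space)
qed

text \<open>Integer horizons suffice, which leaves one null set: continuity at \<open>t\<close> only
  involves a neighbourhood of \<open>t\<close>, and a horizon \<open>n > t\<close> contains one
  relative to \<open>{0..}\<close>.\<close>

lemma as_continuous_AE:
  assumes "as_continuous M F X"
  shows "AE \<omega> in M. continuous_on {0..} (\<lambda>t. X t \<omega>)"
proof -
  have "AE \<omega> in M. \<forall>n::nat. continuous_on {0..real n} (\<lambda>t. X t \<omega>)"
    unfolding AE_all_countable
    using assms AE_restr_to_subalg[OF subalgebra_F[OF of_nat_0_le_iff]]
    unfolding as_continuous_def by (meson of_nat_0_le_iff)
  then show ?thesis
  proof eventually_elim
    case (elim \<omega>)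
    show ?case
      unfolding continuous_on_eq_continuous_within
    proof
      fix t :: real assume t: "t \<in> {0..}"
      obtain n :: nat where n: "t < n" using reals_Archimedean2 by blast
      have "continuous (at t within {0..real n}) (\<lambda>t. X t \<omega>)"
        using elim n t by (auto simp: continuous_on_eq_continuous_within)
      moreover have "at t within {0..real n} = at t within {0..}"
        using t n by (intro at_within_nhd[of _ "{..<real n}"]) auto
      ultimately show "continuous (at t within {0..}) (\<lambda>t. X t \<omega>)"
        by (simp add: continuous_within)
    qed
  qed
qed

end

section \<open>Absorption of nonnegative martingales at zero\<close>

text \<open>
  Only rational times are used, which keeps these events in F t without any regularity of the paths.
\<close>

definition below_on_rationals :: "(real \<Rightarrow> 'a \<Rightarrow> real) \<Rightarrow> real \<Rightarrow> real \<Rightarrow> 'a \<Rightarrow> bool" where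
  "below_on_rationals X e t \<omega> \<longleftrightarrow> (\<exists>q\<in>\<rat> \<inter> {0..t}. X q \<omega> \<le> e)"

definition touches_zero :: "(real \<Rightarrow> 'a \<Rightarrow> real) \<Rightarrow> real \<Rightarrow> 'a \<Rightarrow> bool" where
  "touches_zero X t \<omega> \<longleftrightarrow> (\<forall>k::nat. below_on_rationals X (1 / Suc k) t \<omega>)"

text \<open>The strict \<open>s < t\<close> leaves room for a rational just to the right of
  \<open>s\<close> and still before \<open>t\<close>, where continuity keeps the path below
  \<open>1 / Suc k\<close>.\<close>

lemma continuous_zero_imp_touches_zero:
  assumes cont: "continuous_on {0..} (\<lambda>t. X t \<omega>)" and s: "0 \<le> s" "s < t" "X s \<omega> \<le> 0"
  shows "touches_zero X t \<omega>"
  unfolding touches_zero_def below_on_rationals_def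
proof
  fix k :: nat
  have "((\<lambda>t. X t \<omega>) \<longlongrightarrow> X s \<omega>) (at s within {0..})"
    using cont s by (auto simp: continuous_on_def)
  then have "\<forall>\<^sub>F r in at s within {0..}. X r \<omega> < 1 / Suc k"
    using s by (intro order_tendstoD(2)[where y="X s \<omega>"]) (auto intro: le_less_trans)
  then obtain d where d: "d > 0" "\<And>r. 0 \<le> r \<Longrightarrow> r \<noteq> s \<Longrightarrow> dist r s < d \<Longrightarrow> X r \<omega> < 1 / Suc k"
    unfolding eventually_at by auto
  have "s < min (s + d) t" using d s by auto
  then obtain q where q: "q \<in> \<rat>" "s < q" "q < min (s + d) t" using Rats_dense_in_real by blast
  then have "X q \<omega> < 1 / Suc k" using s by (intro d(2)) (auto simp: dist_real_def)
  then show "\<exists>q\<in>\<rat> \<inter> {0..t}. X q \<omega> \<le> 1 / Suc k"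
    using q s by (intro bexI[of _ q]) auto
qed

context filtered_prob_space
begin

lemma pred_below_on_rationals:
  assumes "\<And>t. 0 \<le> t \<Longrightarrow> X t \<in> borel_measurable (F t)"
  shows "Measurable.pred (F t) (below_on_rationals X e t)"
proof -
  have [measurable]: "X q \<in> borel_measurable (F t)" if "q \<in> \<rat> \<inter> {0..t}" for q
    using measurable_F_mono[OF assms] that by auto
  have "countable (\<rat> \<inter> {0..t})" using countable_rat by (rule countable_Int1)
  then show ?thesis
    unfolding below_on_rationals_def[abs_def]
    by (intro measurable_pred_countable) auto
qed

lemma pred_touches_zero:
  assumes "\<And>t. 0 \<le> t \<Longrightarrow> X t \<in> borel_measurable (F t)"
  shows "Measurable.pred (F t) (touches_zero X t)"
  unfolding touches_zero_def[abs_def]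
  using pred_below_on_rationals[OF assms] by (intro pred_intros_countable) auto

text \<open>Split the event according to the first time in S at which X is at most e.\<close>

lemma integral_below_on_finite_le:
  assumes X: "martingale M F X" and S: "finite S" "S \<subseteq> {0..t}" and e: "0 \<le> e"
  shows "(\<integral>\<omega>\<in>{\<omega>\<in>space M. \<exists>q\<in>S. X q \<omega> \<le> e}. X t \<omega> \<partial>M) \<le> e"
proof -
  define A where "A q = {\<omega>\<in>space M. X q \<omega> \<le> e \<and> (\<forall>p\<in>{p\<in>S. p < q}. e < X p \<omega>)}" for q
  have A[measurable]: "A q \<in> sets (F q)" if "q \<in> S" for q
  proof -
    have [measurable]: "X p \<in> borel_measurable (F q)" if "p \<in> S" "p \<le> q" for p
      using that S measurable_F_mono[OF martingale_adapted[OF X]] by auto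
    have "Measurable.pred (F q) (\<lambda>\<omega>. X q \<omega> \<le> e \<and> (\<forall>p\<in>{p\<in>S. p < q}. e < X p \<omega>))"
      using that S(1) by (intro pred_intros_logic pred_intros_finite) auto
    then have "{\<omega>\<in>space (F q). X q \<omega> \<le> e \<and> (\<forall>p\<in>{p\<in>S. p < q}. e < X p \<omega>)} \<in> sets (F q)"
      by (simp add: pred_def)
    then show ?thesis by (simp add: A_def space_F)
  qed
  have AM[measurable]: "A q \<in> sets M" if "q \<in> S" for q
    using A[OF that] by (rule sets_F_imp)
  have U: "{\<omega>\<in>space M. \<exists>q\<in>S. X q \<omega> \<le> e} = (\<Union>q\<in>S. A q)"
  proof (intro equalityI subsetI)
    fix \<omega> assume w: "\<omega> \<in> {\<omega>\<in>space M. \<exists>q\<in>S. X q \<omega> \<le> e}"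
    define q where "q = Min {q\<in>S. X q \<omega> \<le> e}"
    have "q \<in> {q\<in>S. X q \<omega> \<le> e}" unfolding q_def using w S by (intro Min_in) auto
    moreover have "e < X p \<omega>" if "p \<in> S" "p < q" for p
    proof (rule ccontr)
      assume "\<not> e < X p \<omega>"
      then have "q \<le> p" unfolding q_def using that S by (intro Min_le) auto
      with that show False by simp
    qed
    ultimately show "\<omega> \<in> (\<Union>q\<in>S. A q)" using w by (auto simp: A_def)
  qed (auto simp: A_def)
  have disj: "disjoint_family_on A S"
    unfolding disjoint_family_on_def
  proof (intro ballI impI equals0I)
    fix p q \<omega> assume "p \<in> S" "q \<in> S" "p \<noteq> q" "\<omega> \<in> A p \<inter> A q"
    then show False using linorder_neqE[of p q] by (auto simp: A_def not_less[symmetric])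
  qed
  have int: "set_integrable M (A q) (X s)" if "q \<in> S" "0 \<le> s" for q s
    using that martingale_integrable[OF X] unfolding set_integrable_def
    by (intro integrable_mult_indicator) auto
  have tS: "0 \<le> t" if "q \<in> S" for q using that S by auto
  have "(\<integral>\<omega>\<in>(\<Union>q\<in>S. A q). X t \<omega> \<partial>M) = (\<Sum>q\<in>S. \<integral>\<omega>\<in>A q. X t \<omega> \<partial>M)"
    using S disj int tS by (intro set_integral_finite_Union) auto
  \<comment> \<open>\<open>A q\<close> belongs to \<open>F q\<close>, so the martingale property
    trades \<open>X t\<close> for \<open>X q\<close>, which is at most \<open>e\<close> on
    \<open>A q\<close>.\<close>
  also have "\<dots> = (\<Sum>q\<in>S. \<integral>\<omega>\<in>A q. X q \<omega> \<partial>M)"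
    using S by (intro sum.cong martingale_set_integral[OF X] A) auto
  also have "\<dots> \<le> (\<Sum>q\<in>S. \<integral>\<omega>\<in>A q. e \<partial>M)"
  proof (intro sum_mono set_integral_mono)
    show "set_integrable M (A q) (X q)" if "q \<in> S" for q using int[OF that] that S by auto
    show "set_integrable M (A q) (\<lambda>_. e)" if "q \<in> S" for q
      unfolding set_integrable_def using AM[OF that]
      by (intro integrable_mult_indicator) auto
  qed (auto simp: A_def)
  also have "\<dots> = e * (\<Sum>q\<in>S. prob (A q))"
    by (simp add: sum_distrib_left set_lebesgue_integral_def mult.commute AM cong: sum.cong)
  also have "(\<Sum>q\<in>S. prob (A q)) = prob (\<Union>q\<in>S. A q)"
    using S disj AM by (intro finite_measure_finite_Union[symmetric]) auto
  also have "e * prob (\<Union>q\<in>S. A q) \<le> e * 1" using e by (intro mult_left_mono) auto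
  finally show ?thesis by (simp add: U)
qed

text \<open>Initial segments of an enumeration of the rationals are finite sets; the finite bound
  does not depend on the segment and passes to the limit.\<close>

lemma integral_below_on_rationals_le:
  assumes X: "martingale M F X" and t: "0 \<le> t" and e: "0 \<le> e"
  shows "(\<integral>\<omega>\<in>{\<omega>\<in>space M. below_on_rationals X e t \<omega>}. X t \<omega> \<partial>M) \<le> e"
proof -
  have [measurable]: "X t \<in> borel_measurable M" "integrable M (X t)"
    using martingale_integrable[OF X t] by auto
  define r where "r = from_nat_into (\<rat> \<inter> {0..t})"
  have ne: "\<rat> \<inter> {0..t} \<noteq> {}" "countable (\<rat> \<inter> {0..t})"
    using t by (auto intro: countable_Int1 countable_rat intro!: exI[of _ 0])
  have r: "range r = \<rat> \<inter> {0..t}" unfolding r_def by (rule range_from_nat_into[OF ne])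
  define B where "B n = {\<omega>\<in>space M. \<exists>q\<in>r ` {..n}. X q \<omega> \<le> e}" for n
  have rM: "X (r i) \<in> borel_measurable M" for i
    using r by (intro measurable_F_imp[OF martingale_adapted[OF X]]) auto
  have B[measurable]: "B n \<in> sets M" for n
  proof -
    have "Measurable.pred M (\<lambda>\<omega>. \<exists>q\<in>r ` {..n}. X q \<omega> \<le> e)"
      using rM by (intro pred_intros_finite) auto
    then show ?thesis unfolding B_def by (simp add: pred_def)
  qed
  have U: "{\<omega>\<in>space M. below_on_rationals X e t \<omega>} = (\<Union>n. B n)"
    unfolding below_on_rationals_def r[symmetric] B_def by auto
  have "(\<lambda>n. \<integral>\<omega>\<in>B n. X t \<omega> \<partial>M) \<longlonglongrightarrow> (\<integral>\<omega>\<in>(\<Union>n. B n). X t \<omega> \<partial>M)"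
  proof (rule set_integral_cont_up)
    show "incseq B" by (auto simp: incseq_def B_def)
    show "set_integrable M (\<Union>n. B n) (X t)"
      unfolding set_integrable_def using \<open>integrable M (X t)\<close> by (intro integrable_mult_indicator) auto
  qed (rule B)
  moreover have "(\<integral>\<omega>\<in>B n. X t \<omega> \<partial>M) \<le> e" for n
    unfolding B_def using r by (intro integral_below_on_finite_le[OF X _ _ e]) auto
  ultimately show ?thesis unfolding U by (intro LIMSEQ_le_const2) auto
qed

text \<open>Touching zero puts the path below every level \<open>1 / Suc k\<close>. As
  \<open>X t\<close> is nonnegative, its integral over this event is at most
  \<open>1 / Suc k\<close> for each \<open>k\<close>, hence 0.\<close>

lemma martingale_absorbed_at_zero:
  assumes X: "martingale M F X" and nn: "AE \<omega> in M. 0 \<le> X t \<omega>" and t: "0 \<le> t"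
  shows "AE \<omega> in M. touches_zero X t \<omega> \<longrightarrow> X t \<omega> = 0"
proof -
  define Z where "Z = {\<omega>\<in>space M. touches_zero X t \<omega>}"
  have [measurable]: "Z \<in> sets M"
    using measurable_F_imp[OF pred_touches_zero[OF martingale_adapted[OF X]]]
    unfolding Z_def pred_def by simp
  have B[measurable]: "{\<omega>\<in>space M. below_on_rationals X e t \<omega>} \<in> sets M" for e
    using measurable_F_imp[OF pred_below_on_rationals[OF martingale_adapted[OF X]]]
    unfolding pred_def by simp
  have int: "integrable M (X t)" by (rule martingale_integrable[OF X t])
  have le: "(\<integral>\<omega>\<in>Z. X t \<omega> \<partial>M) \<le> 1 / Suc k" for k
  proof -
    have "(\<integral>\<omega>\<in>Z. X t \<omega> \<partial>M) \<le> (\<integral>\<omega>\<in>{\<omega>\<in>space M. below_on_rationals X (1 / Suc k) t \<omega>}. X t \<omega> \<partial>M)"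
      unfolding set_lebesgue_integral_def
    proof (rule integral_mono_AE)
      show "AE x in M. indicat_real Z x *\<^sub>R X t x
        \<le> indicat_real {\<omega> \<in> space M. below_on_rationals X (1 / Suc k) t \<omega>} x *\<^sub>R X t x"
        using nn by eventually_elim (auto simp: Z_def touches_zero_def indicator_def)
    qed (use int B in \<open>auto intro!: integrable_mult_indicator simp del: real_scaleR_def\<close>)
    also have "\<dots> \<le> 1 / Suc k" by (rule integral_below_on_rationals_le[OF X t]) simp
    finally show ?thesis .
  qed
  have "(\<integral>\<omega>\<in>Z. X t \<omega> \<partial>M) \<le> 0"
    by (rule LIMSEQ_le_const[OF LIMSEQ_Suc[OF lim_inverse_n']]) (use le in auto)
  moreover have "0 \<le> (\<integral>\<omega>\<in>Z. X t \<omega> \<partial>M)"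
    unfolding set_lebesgue_integral_def using nn
    by (intro integral_nonneg_AE) (auto simp: indicator_def)
  ultimately have 0: "(\<integral>\<omega>. indicator Z \<omega> * X t \<omega> \<partial>M) = 0" by (simp add: set_lebesgue_integral_def)
  have "integrable M (\<lambda>\<omega>. indicator Z \<omega> * X t \<omega>)"
    using integrable_mult_indicator[OF \<open>Z \<in> sets M\<close> int] by simp
  moreover have "AE \<omega> in M. 0 \<le> indicator Z \<omega> * X t \<omega>"
    using nn by eventually_elim simp
  ultimately have "AE \<omega> in M. indicator Z \<omega> * X t \<omega> = 0"
    using 0 by (rule integral_nonneg_eq_0_iff_AE[THEN iffD1])
  then show ?thesis using AE_space by eventually_elim (auto simp: Z_def)
qed

end

section \<open>Change of measure and positivity of the density\<close>

locale density_process = Q: filtered_prob_space Q F + P: prob_space P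
  for P Q :: "'a measure" and F :: "real \<Rightarrow> 'a measure" +
  fixes h :: "real \<Rightarrow> 'a \<Rightarrow> real"
  assumes sets_eq: "sets P = sets Q"
    and locally_ac: "locally_abs_continuous P Q F"
    and RN_h: "RN_process P Q F h"
begin

lemma space_eq: "space P = space Q"
  by (rule sets_eq_imp_space_eq[OF sets_eq])

sublocale P: filtered_prob_space P F
  using Q.filtration_axioms Q.subalgebra_F
  by unfold_locales (auto simp: space_eq sets_eq subalgebra_def Q.space_F dest: Q.sets_F_imp Q.sets_F_mono)

lemma h_adapted: "0 \<le> t \<Longrightarrow> h t \<in> borel_measurable (F t)"
  using RN_h by (simp add: RN_process_def)

text \<open>Absolute continuity is only available on \<open>F t\<close>, so the exceptional set has
  to lie there. This is how almost sure path properties are carried from Q to P.\<close>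

lemma AE_restr_Q_imp_P:
  assumes t: "0 \<le> t" and A: "AE \<omega> in restr_to_subalg Q (F t). A \<omega>"
  shows "AE \<omega> in restr_to_subalg P (F t). A \<omega>"
proof -
  let ?Q = "restr_to_subalg Q (F t)" and ?P = "restr_to_subalg P (F t)"
  from A obtain N where N: "{\<omega>\<in>space ?Q. \<not> A \<omega>} \<subseteq> N" "N \<in> null_sets ?Q"
    by (auto simp: eventually_ae_filter)
  then have "N \<in> null_sets ?P"
    using locally_ac t by (auto simp: locally_abs_continuous_def absolutely_continuous_def)
  then show ?thesis
    using N(1) by (auto simp: eventually_ae_filter space_restr_to_subalg space_eq)
qed

lemma as_continuous_AE_P:
  assumes "as_continuous Q F X"
  shows "AE \<omega> in P. continuous_on {0..} (\<lambda>t. X t \<omega>)"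
proof -
  have "as_continuous P F X"
    using assms unfolding as_continuous_def by (intro allI impI AE_restr_Q_imp_P) simp_all
  then show ?thesis by (rule P.as_continuous_AE)
qed

text \<open>A density is given only on \<open>F t\<close>, so both measures are restricted to
  \<open>F t\<close> before the Radon-Nikodym derivative is used; for \<open>g\<close> measurable in
  \<open>F t\<close> the restriction changes neither integrability nor the integral.\<close>

lemma
  assumes t: "0 \<le> t"
  shows h_nonneg: "AE \<omega> in Q. 0 \<le> h t \<omega>"
    and integrable_P_iff: "g \<in> borel_measurable (F t) \<Longrightarrow>
      integrable P g \<longleftrightarrow> integrable Q (\<lambda>\<omega>. h t \<omega> * g \<omega>)"
    and integral_P_eq: "g \<in> borel_measurable (F t) \<Longrightarrow>
      (\<integral>\<omega>. g \<omega> \<partial>P) = (\<integral>\<omega>. h t \<omega> * g \<omega> \<partial>Q)"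
proof -
  let ?Q = "restr_to_subalg Q (F t)" and ?P = "restr_to_subalg P (F t)"
  note sQ = Q.subalgebra_F[OF t] and sP = P.subalgebra_F[OF t]
  interpret rQ: prob_space ?Q by (rule prob_space_restr_to_subalg[OF sQ Q.prob_space_axioms])
  interpret rP: prob_space ?P by (rule prob_space_restr_to_subalg[OF sP P.prob_space_axioms])
  have ac: "absolutely_continuous ?Q ?P"
    using locally_ac t by (simp add: locally_abs_continuous_def)
  have sets: "sets ?P = sets ?Q"
    by (simp add: sets_restr_to_subalg[OF sQ] sets_restr_to_subalg[OF sP])
  define D where "D = RN_deriv ?Q ?P"
  have D: "AE \<omega> in Q. h t \<omega> = enn2real (D \<omega>)"
    using RN_h t by (simp add: RN_process_def D_def)
  then show "AE \<omega> in Q. 0 \<le> h t \<omega>" by eventually_elim simp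
  have D_F: "(\<lambda>\<omega>. enn2real (D \<omega>)) \<in> borel_measurable (F t)"
    unfolding D_def by (rule measurable_in_subalg'[OF sQ]) measurable
  assume g: "g \<in> borel_measurable (F t)"
  note [measurable] = Q.measurable_F_imp[OF g] Q.measurable_F_imp[OF h_adapted[OF t]]
    Q.measurable_F_imp[OF D_F]
  have gQ: "g \<in> borel_measurable ?Q" by (rule measurable_in_subalg[OF sQ g])
  have "integrable P g \<longleftrightarrow> integrable ?P g"
    using integrable_from_subalg[OF sP] integrable_in_subalg[OF sP g] by auto
  also have "\<dots> \<longleftrightarrow> integrable ?Q (\<lambda>\<omega>. enn2real (D \<omega>) * g \<omega>)"
    unfolding D_def
    by (rule rQ.RN_deriv_integrable[OF rP.sigma_finite_measure_axioms ac sets gQ])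
  also have "\<dots> \<longleftrightarrow> integrable Q (\<lambda>\<omega>. enn2real (D \<omega>) * g \<omega>)"
    using integrable_from_subalg[OF sQ] integrable_in_subalg[OF sQ borel_measurable_times[OF D_F g]] by auto
  also have "\<dots> \<longleftrightarrow> integrable Q (\<lambda>\<omega>. h t \<omega> * g \<omega>)"
    using D by (intro integrable_cong_AE) auto
  finally show "integrable P g \<longleftrightarrow> integrable Q (\<lambda>\<omega>. h t \<omega> * g \<omega>)" .
  have "(\<integral>\<omega>. g \<omega> \<partial>P) = (\<integral>\<omega>. g \<omega> \<partial>?P)"
    by (rule integral_subalgebra2[OF sP g, symmetric])
  also have "\<dots> = (\<integral>\<omega>. enn2real (D \<omega>) * g \<omega> \<partial>?Q)"
    unfolding D_def
    by (rule rQ.RN_deriv_integral[OF rP.sigma_finite_measure_axioms ac sets gQ])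
  also have "\<dots> = (\<integral>\<omega>. enn2real (D \<omega>) * g \<omega> \<partial>Q)"
    by (rule integral_subalgebra2[OF sQ borel_measurable_times[OF D_F g]])
  also have "\<dots> = (\<integral>\<omega>. h t \<omega> * g \<omega> \<partial>Q)"
    using D by (intro integral_cong_AE) auto
  finally show "(\<integral>\<omega>. g \<omega> \<partial>P) = (\<integral>\<omega>. h t \<omega> * g \<omega> \<partial>Q)" .
qed

text \<open>For \<open>A\<close> in \<open>F s\<close>, the integral of \<open>h u\<close> over
  \<open>A\<close> is P(A) for every \<open>u \<ge> s\<close>, by the change of measure at time
  \<open>u\<close>.\<close>

lemma h_martingale: "martingale Q F h"
  unfolding Q.martingale_iff
proof (intro conjI allI impI ballI)
  fix t :: real assume t: "0 \<le> t"
  show "h t \<in> borel_measurable (F t)" by (rule h_adapted[OF t])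
  show "integrable Q (h t)" using integrable_P_iff[OF t, of "\<lambda>_. 1"] by simp
next
  fix s t :: real and A assume st: "0 \<le> s" "s \<le> t" and A: "A \<in> sets (F s)"
  have "(\<integral>\<omega>\<in>A. h u \<omega> \<partial>Q) = (\<integral>\<omega>. indicator A \<omega> \<partial>P)" if "s \<le> u" for u
    using integral_P_eq[of u "indicator A"] A Q.sets_F_mono[OF that] st that
    by (auto simp: set_lebesgue_integral_def mult.commute)
  then show "(\<integral>\<omega>\<in>A. h t \<omega> \<partial>Q) = (\<integral>\<omega>\<in>A. h s \<omega> \<partial>Q)" using st by simp
qed

lemma h_absorbed_at_zero:
  "0 \<le> t \<Longrightarrow> AE \<omega> in Q. touches_zero h t \<omega> \<longrightarrow> h t \<omega> = 0"
  by (rule Q.martingale_absorbed_at_zero[OF h_martingale h_nonneg])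

text \<open>The event lies in \<open>F n\<close>, so its P-probability is the Q-integral of
  \<open>h n\<close> over it, and absorption makes \<open>h n\<close> vanish there.\<close>

lemma h_not_touches_zero_P: "AE \<omega> in P. \<forall>n::nat. \<not> touches_zero h n \<omega>"
  unfolding AE_all_countable
proof
  fix n :: nat
  define Z where "Z = {\<omega>\<in>space Q. touches_zero h n \<omega>}"
  have Z: "Z \<in> sets (F n)"
    using Q.pred_touches_zero[OF h_adapted, of n] by (simp add: Z_def pred_def Q.space_F)
  have "(\<integral>\<omega>. indicator Z \<omega> \<partial>P) = (\<integral>\<omega>. h n \<omega> * indicator Z \<omega> \<partial>Q)"
    using Z by (intro integral_P_eq) auto
  also have "\<dots> = (\<integral>\<omega>. 0 \<partial>Q)"
    using h_absorbed_at_zero[of n] Q.sets_F_imp[OF Z] Q.measurable_F_imp[OF h_adapted[of n]]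
    by (intro integral_cong_AE) (auto simp: Z_def elim!: eventually_mono split: split_indicator)
  finally have "P.prob Z = 0" using P.sets_F_imp[OF Z] by simp
  then have "AE \<omega> in P. \<omega> \<notin> Z"
    using P.sets_F_imp[OF Z] by (subst P.prob_eq_0[symmetric]) auto
  then show "AE \<omega> in P. \<not> touches_zero h n \<omega>"
    using AE_space by eventually_elim (auto simp: Z_def space_eq)
qed

end

section \<open>The quotient at fixed times\<close>

locale density_martingale = density_process P Q F h
  for P Q :: "'a measure" and F h +
  fixes f :: "real \<Rightarrow> 'a \<Rightarrow> real"
  assumes h_cont: "as_continuous Q F h"
    and f_martingale: "martingale Q F f"
    and f_cont: "as_continuous Q F f"
begin

lemmas f_adapted = Q.martingale_adapted[OF f_martingale]
  and f_integrable = Q.martingale_integrable[OF f_martingale]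
  and f_set_integral = Q.martingale_set_integral[OF f_martingale]

text \<open>Division by zero gives 0, so \<open>N t\<close> vanishes where \<open>h t\<close> does.
  This makes \<open>h_times_N\<close> an identity at every point, without an exceptional
  set.\<close>

definition N :: "real \<Rightarrow> 'a \<Rightarrow> real" where
  "N t \<omega> = f t \<omega> / h t \<omega>"

lemma N_adapted: "0 \<le> t \<Longrightarrow> N t \<in> borel_measurable (F t)"
  unfolding N_def[abs_def] using f_adapted h_adapted by (intro borel_measurable_divide) auto

lemma h_times_N: "h t \<omega> * N t \<omega> = indicator {\<omega>. h t \<omega> \<noteq> 0} \<omega> * f t \<omega>"
  by (simp add: N_def)

text \<open>Weighted by the density, \<open>N t\<close> is just \<open>f t\<close> cut off where
  \<open>h t = 0\<close>. Integrability thus never fails, and strictness has to come from lost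
  mass.\<close>

lemma N_integrable:
  assumes t: "0 \<le> t"
  shows "integrable P (N t)"
proof -
  have [measurable]: "h t \<in> borel_measurable Q" by (rule Q.measurable_F_imp[OF h_adapted[OF t]])
  have "integrable Q (\<lambda>\<omega>. indicator {\<omega>\<in>space Q. h t \<omega> \<noteq> 0} \<omega> *\<^sub>R f t \<omega>)"
    using f_integrable[OF t] by (intro integrable_mult_indicator) auto
  then have "integrable Q (\<lambda>\<omega>. h t \<omega> * N t \<omega>)"
    unfolding h_times_N
    by (rule Bochner_Integration.integrable_cong[THEN iffD1, rotated 2]) (auto simp: indicator_def)
  then show ?thesis using integrable_P_iff[OF t N_adapted[OF t]] by simp
qed

lemma set_integral_N:
  assumes t: "0 \<le> t" and A: "A \<in> sets (F t)"
  shows "(\<integral>\<omega>\<in>A. N t \<omega> \<partial>P) = (\<integral>\<omega>\<in>A \<inter> {\<omega>. h t \<omega> \<noteq> 0}. f t \<omega> \<partial>Q)"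
proof -
  have "(\<integral>\<omega>\<in>A. N t \<omega> \<partial>P) = (\<integral>\<omega>. h t \<omega> * (indicator A \<omega> * N t \<omega>) \<partial>Q)"
    unfolding set_lebesgue_integral_def using A N_adapted[OF t]
    by (simp add: integral_P_eq[OF t])
  also have "\<dots> = (\<integral>\<omega>\<in>A \<inter> {\<omega>. h t \<omega> \<noteq> 0}. f t \<omega> \<partial>Q)"
    unfolding set_lebesgue_integral_def
    by (intro Bochner_Integration.integral_cong) (auto simp: N_def indicator_def)
  finally show ?thesis .
qed

end

section \<open>First passage times in a raw filtration\<close>

text \<open>Rational points and tolerances of the form \<open>1 / Suc k\<close> leave only countable
  quantifiers, so for an adapted process this is an event of the filtration at time
  \<open>r\<close>.\<close>

definition rationally_uniformly_continuous :: "(real \<Rightarrow> real) \<Rightarrow> real \<Rightarrow> bool" where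
  "rationally_uniformly_continuous x r \<longleftrightarrow> (\<forall>k::nat. \<exists>m::nat. \<forall>p\<in>\<rat> \<inter> {0..r}. \<forall>q\<in>\<rat> \<inter> {0..r}.
     \<bar>p - q\<bar> < 1 / Suc m \<longrightarrow> \<bar>x p - x q\<bar> < 1 / Suc k)"

text \<open>
  For a continuous path and t > 0 this says that the path has reached a level at most c by time t.
  The definition uses only rational times before t, so the event belongs to F t for every path. The
  uniform continuity clause makes the interval of such t closed on the left for all paths; this
  is what turns the first passage time into a stopping time of a filtration that is neither complete
  nor right-continuous.
\<close>

definition passed_below :: "(real \<Rightarrow> real) \<Rightarrow> real \<Rightarrow> real \<Rightarrow> bool" where
  "passed_below x c t \<longleftrightarrow> x 0 \<le> c \<or>
     (\<forall>k::nat. \<exists>r\<in>\<rat> \<inter> {0<..<t}. rationally_uniformly_continuous x r \<and>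
        (\<exists>q\<in>\<rat> \<inter> {0..<r}. x q < c + 1 / Suc k))"

text \<open>The cap \<open>K\<close> keeps the set nonempty for every path, so that the infimum is a
  genuine real number and the time is bounded.\<close>

definition first_passage :: "(real \<Rightarrow> real) \<Rightarrow> real \<Rightarrow> real \<Rightarrow> real" where
  "first_passage x c K = Inf {t. 0 \<le> t \<and> (K \<le> t \<or> passed_below x c t)}"

lemma rationally_uniformly_continuous_antimono:
  "rationally_uniformly_continuous x r \<Longrightarrow> s \<le> r \<Longrightarrow> rationally_uniformly_continuous x s"
  unfolding rationally_uniformly_continuous_def
  by (elim all_forward ex_forward) (use order_trans[of _ s r] in auto)

lemma passed_below_mono:
  assumes "passed_below x c s" "c \<le> d" "s \<le> t"
  shows "passed_below x d t"
proof (cases "x 0 \<le> d")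
  case False
  have x0: "\<not> x 0 \<le> c" using False assms(2) by simp
  have "\<exists>r\<in>\<rat> \<inter> {0<..<t}. rationally_uniformly_continuous x r \<and>
        (\<exists>q\<in>\<rat> \<inter> {0..<r}. x q < d + 1 / Suc k)" for k :: nat
  proof -
    obtain r q where "r \<in> \<rat> \<inter> {0<..<s}" "rationally_uniformly_continuous x r"
        "q \<in> \<rat> \<inter> {0..<r}" "x q < c + 1 / Suc k"
      using assms(1) x0 unfolding passed_below_def by blast
    then show ?thesis using assms by (intro bexI[of _ r] conjI bexI[of _ q]) auto
  qed
  then show ?thesis unfolding passed_below_def by blast
qed (simp add: passed_below_def)

text \<open>If the passage is seen at all later times but not at \<open>t\<close>, there are
  rationals just after \<open>t\<close> with values close to \<open>c\<close>, while the values
  before \<open>t\<close> keep a fixed distance from \<open>c\<close>. Uniform continuity on one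
  interval reaching beyond \<open>t\<close> excludes such a jump.\<close>

lemma passed_below_right_closed:
  assumes t: "0 \<le> t" and after: "\<And>s. t < s \<Longrightarrow> passed_below x c s"
  shows "passed_below x c t"
proof (rule ccontr)
  let ?uc = "rationally_uniformly_continuous x"
  assume not: "\<not> passed_below x c t"
  then have x0: "c < x 0" by (auto simp: passed_below_def)
  obtain k1 where k1: "\<And>r q. r \<in> \<rat> \<Longrightarrow> 0 < r \<Longrightarrow> r < t \<Longrightarrow> ?uc r \<Longrightarrow> q \<in> \<rat> \<Longrightarrow> 0 \<le> q \<Longrightarrow> q < r
      \<Longrightarrow> c + 1 / Suc k1 \<le> x q"
  proof -
    obtain k1 where k1: "\<not> (\<exists>r\<in>\<rat> \<inter> {0<..<t}. ?uc r \<and> (\<exists>q\<in>\<rat> \<inter> {0..<r}. x q < c + 1 / Suc k1))"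
      using not unfolding passed_below_def by blast
    show ?thesis
    proof (rule that[of k1], rule ccontr)
      fix r q
      assume "r \<in> \<rat>" "0 < r" "r < t" "?uc r" "q \<in> \<rat>" "0 \<le> q" "q < r" "\<not> c + 1 / Suc k1 \<le> x q"
      then have "r \<in> \<rat> \<inter> {0<..<t}" "q \<in> \<rat> \<inter> {0..<r}" "?uc r" "x q < c + 1 / Suc k1" by auto
      with k1 show False by blast
    qed
  qed
  \<comment> \<open>For \<open>t = 0\<close> the gap \<open>k1\<close> is vacuous, as no
    \<open>r\<close> lies in \<open>{0<..<t}\<close>; the role of the values before \<open>t\<close>
    is then played by \<open>x 0\<close>.\<close>
  obtain k2 :: nat where k2: "1 / Suc k2 < x 0 - c"
    using x0 nat_approx_posE[of "x 0 - c"] by auto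
  define k0 where "k0 = max k1 k2"
  have "1 / real (Suc k0) \<le> 1 / Suc k1" "1 / real (Suc k0) \<le> 1 / Suc k2"
    unfolding k0_def by (intro divide_left_mono; simp)+
  note k0_le = this
  have k0: "c + 1 / Suc k0 \<le> x q" if "r \<in> \<rat>" "r < t" "?uc r" "q \<in> \<rat>" "0 \<le> q" "q < r" for r q
    using k1[of r q] that k0_le(1) by linarith
  have k0x: "1 / Suc k0 < x 0 - c" using k2 k0_le(2) by linarith
  have witness: "\<exists>r q. r \<in> \<rat> \<and> ?uc r \<and> q \<in> \<rat> \<and> 0 \<le> q \<and> q < r \<and> r < s \<and> x q < c + 1 / Suc k"
    if "t < s" for s and k :: nat
  proof -
    have "\<exists>r\<in>\<rat> \<inter> {0<..<s}. ?uc r \<and> (\<exists>q\<in>\<rat> \<inter> {0..<r}. x q < c + 1 / Suc k)"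
      using after[OF that] x0 unfolding passed_below_def by (meson not_less)
    then obtain r q where "r \<in> \<rat> \<inter> {0<..<s}" "?uc r" "q \<in> \<rat> \<inter> {0..<r}" "x q < c + 1 / Suc k" by blast
    then show ?thesis by (intro exI[of _ r] exI[of _ q]) simp
  qed
  \<comment> \<open>A low rational \<open>q < t\<close> would have a rational horizon
    \<open>r'\<close> between \<open>q\<close> and \<open>min t r\<close>, and so would already
    witness the passage at \<open>t\<close>.\<close>
  have low: "t \<le> q" if "r \<in> \<rat>" "?uc r" "q \<in> \<rat>" "0 \<le> q" "q < r" "x q < c + 1 / Suc k0" for r q
  proof (rule ccontr)
    assume "\<not> t \<le> q"
    then have "q < min t r" using that by auto
    then obtain r' where r': "r' \<in> \<rat>" "q < r'" "r' < min t r" using Rats_dense_in_real by blast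
    then have "?uc r'" using rationally_uniformly_continuous_antimono[OF that(2), of r'] by auto
    then have "c + 1 / Suc k0 \<le> x q" using r' that by (intro k0[of r']) auto
    then show False using that by simp
  qed
  \<comment> \<open>Fixes one horizon on which uniform continuity is known; \<open>low\<close> shows
    that it lies beyond \<open>t\<close>.\<close>
  obtain r1 q1 where r1: "r1 \<in> \<rat>" "?uc r1" "q1 \<in> \<rat>" "0 \<le> q1" "q1 < r1" "x q1 < c + 1 / Suc k0"
    using witness[of "t + 1" k0] by auto
  have tr1: "t < r1" using low[OF r1] r1 by simp
  \<comment> \<open>Chosen so that \<open>1 / Suc K\<close> is half of \<open>1 / Suc k0\<close>:
    one half for the value at \<open>q2\<close>, one for the oscillation.\<close>
  define K where "K = 2 * k0 + 1"
  have K: "1 / real (Suc K) + 1 / real (Suc K) = 1 / Suc k0"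
    unfolding K_def by (simp add: field_simps)
  obtain m where m: "\<And>p q. p \<in> \<rat> \<Longrightarrow> q \<in> \<rat> \<Longrightarrow> 0 \<le> p \<Longrightarrow> p \<le> r1 \<Longrightarrow> 0 \<le> q \<Longrightarrow> q \<le> r1 \<Longrightarrow>
      \<bar>p - q\<bar> < 1 / Suc m \<Longrightarrow> \<bar>x p - x q\<bar> < 1 / Suc K"
    using r1(2) unfolding rationally_uniformly_continuous_def by (metis Int_iff atLeastAtMost_iff)
  define \<delta> where "\<delta> = 1 / real (Suc m)"
  have \<delta>: "0 < \<delta>" by (simp add: \<delta>_def)
  define u where "u = min r1 (t + \<delta> / 2)"
  have "t < u" using tr1 \<delta> by (simp add: u_def)
  then obtain r2 q2 where r2: "r2 \<in> \<rat>" "?uc r2" "q2 \<in> \<rat>" "0 \<le> q2" "q2 < r2" "x q2 < c + 1 / Suc K"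
      and r2u: "r2 < u"
    using witness[of u K] by blast
  have "1 / real (Suc K) \<le> 1 / Suc k0" 
    unfolding K_def by (intro divide_left_mono) auto
  then have tq2: "t \<le> q2" using r2 by (intro low[of r2]) auto
  have q2: "q2 \<le> r1" "q2 < t + \<delta> / 2" using r2 r2u by (auto simp: u_def)
  \<comment> \<open>The low value at \<open>q2\<close> is carried back to a point where the value
    must be high: to 0 itself if \<open>t = 0\<close>, otherwise to a rational
    \<open>q3 < t\<close>.\<close>
  show False
  proof (cases "t = 0")
    case True
    then have "\<bar>0 - q2\<bar> < \<delta>" using q2 r2 \<delta> by linarith
    then have "\<bar>0 - q2\<bar> < 1 / Suc m" by (simp only: \<delta>_def)
    then have "\<bar>x 0 - x q2\<bar> < 1 / Suc K" using q2 tr1 r2 True by (intro m) simp_all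
    then show False using r2 K k0x by linarith
  next
    case False
    with t \<delta> have "max 0 (t - \<delta> / 2) < t" by auto
    then obtain q3 where q3: "q3 \<in> \<rat>" "max 0 (t - \<delta> / 2) < q3" "q3 < t"
      using Rats_dense_in_real by blast
    have "\<bar>q3 - q2\<bar> < \<delta>" using q2 q3 tq2 by linarith
    then have "\<bar>q3 - q2\<bar> < 1 / Suc m" by (simp only: \<delta>_def)
    then have "\<bar>x q3 - x q2\<bar> < 1 / Suc K" using q2 q3 tr1 r2 by (intro m) simp_all
    then have "x q3 < c + 1 / Suc k0" using r2 K by linarith
    then have "t \<le> q3" using q3 r1 tr1 by (intro low[of r1]) auto
    then show False using q3 by simp
  qed
qed

text \<open>The infimum is attained by \<open>passed_below_right_closed\<close>. Hence the passage
  is decided at time \<open>t\<close> itself and not only immediately after it, as a stopping time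
  requires.\<close>

lemma first_passage_le_iff:
  assumes K: "0 \<le> K"
  shows "first_passage x c K \<le> t \<longleftrightarrow> 0 \<le> t \<and> (K \<le> t \<or> passed_below x c t)"
proof
  let ?S = "{t. 0 \<le> t \<and> (K \<le> t \<or> passed_below x c t)}"
  have ne: "?S \<noteq> {}" and bdd: "bdd_below ?S" using K by (auto intro!: bdd_belowI[of _ 0])
  show "first_passage x c K \<le> t" if "0 \<le> t \<and> (K \<le> t \<or> passed_below x c t)"
    unfolding first_passage_def using bdd that by (intro cInf_lower) auto
  assume le: "first_passage x c K \<le> t"
  have *: "0 \<le> s \<and> (K \<le> s \<or> passed_below x c s)" if "t < s" for s
  proof -
    from le that have "Inf ?S < s" by (simp add: first_passage_def)
    then obtain u where "u \<in> ?S" "u < s" using cInf_less_iff[OF ne bdd] by auto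
    then show ?thesis using passed_below_mono[of x c u c s] by auto
  qed
  have "0 \<le> t" using *[THEN conjunct1] dense_ge[of t 0] by auto
  moreover have "passed_below x c t" if "t < K"
  proof (rule passed_below_right_closed[OF \<open>0 \<le> t\<close>])
    fix s assume "t < s"
    then have "t < min s K" using that by simp
    then obtain u where u: "t < u" "u < min s K" using dense by blast
    then have "passed_below x c u" using *[of u] by auto
    then show "passed_below x c s" using u passed_below_mono[of x c u c s] by auto
  qed
  ultimately show "0 \<le> t \<and> (K \<le> t \<or> passed_below x c t)" by (cases "t < K") auto
qed

lemma first_passage_nonneg: "0 \<le> K \<Longrightarrow> 0 \<le> first_passage x c K"
  using first_passage_le_iff[of K x c "first_passage x c K"] by simp

lemma first_passage_mono:
  assumes "0 \<le> K" "K \<le> L" "d \<le> c"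
  shows "first_passage x c K \<le> first_passage x d L"
proof -
  have "0 \<le> first_passage x d L \<and> (L \<le> first_passage x d L \<or> passed_below x d (first_passage x d L))"
    using assms first_passage_le_iff[of L x d "first_passage x d L"] by simp
  then show ?thesis
    using assms passed_below_mono[of x d _ c "first_passage x d L"] by (subst first_passage_le_iff) auto
qed

context
  fixes x :: "real \<Rightarrow> real"
  assumes cont: "continuous_on {0..} x"
begin

lemma continuous_imp_rationally_uniformly_continuous: "rationally_uniformly_continuous x r"
proof -
  have "uniformly_continuous_on {0..r} x"
    using cont by (intro compact_uniformly_continuous) (auto intro: continuous_on_subset)
  then have u: "\<exists>d>0. \<forall>p\<in>{0..r}. \<forall>q\<in>{0..r}. dist q p < d \<longrightarrow> dist (x q) (x p) < 1 / Suc k" for k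
    unfolding uniformly_continuous_on_def by (metis of_nat_0_less_iff zero_less_Suc zero_less_divide_1_iff)
  show ?thesis
    unfolding rationally_uniformly_continuous_def
  proof
    fix k
    obtain d where d: "d > 0" "\<And>p q. p\<in>{0..r} \<Longrightarrow> q\<in>{0..r} \<Longrightarrow> dist q p < d \<Longrightarrow> dist (x q) (x p) < 1 / Suc k"
      using u by blast
    obtain m where m: "1 / Suc m < d" using nat_approx_posE[OF d(1)] by auto
    have "\<bar>x p - x q\<bar> < 1 / Suc k" if "p \<in> {0..r}" "q \<in> {0..r}" "\<bar>p - q\<bar> < 1 / Suc m" for p q
      using d(2)[of q p] that m by (auto simp: dist_real_def)
    then show "\<exists>m::nat. \<forall>p\<in>\<rat> \<inter> {0..r}. \<forall>q\<in>\<rat> \<inter> {0..r}. \<bar>p - q\<bar> < 1 / Suc m \<longrightarrow> \<bar>x p - x q\<bar> < 1 / Suc k"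
      by blast
  qed
qed

text \<open>The tolerance \<open>1 / Suc k\<close> is what lets a level reached exactly at
  \<open>t\<close> be recognized from rational times strictly before \<open>t\<close>.\<close>

lemma passed_below_if_le:
  assumes t: "0 \<le> t" and le: "x t \<le> c"
  shows "passed_below x c t"
proof (cases "t = 0")
  case True
  then show ?thesis using le by (simp add: passed_below_def)
next
  case False
  have "\<exists>r\<in>\<rat> \<inter> {0<..<t}. rationally_uniformly_continuous x r \<and> (\<exists>q\<in>\<rat> \<inter> {0..<r}. x q < c + 1 / Suc k)" for k :: nat
  proof -
    have "(x \<longlongrightarrow> x t) (at t within {0..})"
      using cont t by (auto simp: continuous_on_def)
    then have "\<forall>\<^sub>F s in at t within {0..}. x s < c + 1 / Suc k"
      using le by (intro order_tendstoD(2)[where y="x t"]) (auto intro: le_less_trans)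
    then obtain d where d: "d > 0" "\<And>s. 0 \<le> s \<Longrightarrow> s \<noteq> t \<Longrightarrow> dist s t < d \<Longrightarrow> x s < c + 1 / Suc k"
      unfolding eventually_at by auto
    have "max 0 (t - d) < t" using d False t by auto
    then obtain q where q: "q \<in> \<rat>" "max 0 (t - d) < q" "q < t" using Rats_dense_in_real by blast
    then obtain r where r: "r \<in> \<rat>" "q < r" "r < t" using Rats_dense_in_real by blast
    have "x q < c + 1 / Suc k" using q by (intro d(2)) (auto simp: dist_real_def)
    then show ?thesis
      using q r continuous_imp_rationally_uniformly_continuous[of r]
      by (intro bexI[of _ r] conjI bexI[of _ q]) auto
  qed
  then show ?thesis unfolding passed_below_def by blast
qed

text \<open>On the compact interval \<open>{0..t}\<close> the path attains its minimum, so staying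
  above \<open>c\<close> leaves a positive gap, which some \<open>1 / Suc k\<close>
  undercuts.\<close>

lemma le_first_passage:
  fixes t c :: real
  assumes "0 \<le> t" "t \<le> K" and above: "\<And>s. 0 \<le> s \<Longrightarrow> s \<le> t \<Longrightarrow> c < x s"
  shows "t \<le> first_passage x c K"
proof (rule ccontr)
  let ?T = "first_passage x c K"
  assume "\<not> t \<le> ?T"
  moreover have "0 \<le> ?T" "K \<le> ?T \<or> passed_below x c ?T"
    using first_passage_le_iff[of K x c ?T] assms by auto
  ultimately have "passed_below x c t" using assms passed_below_mono[of x c ?T c t] by auto
  then have *: "\<exists>q\<in>{0..t}. x q < c + 1 / Suc k" for k :: nat
    using above[of 0] assms(1) unfolding passed_below_def by fastforce
  obtain u where u: "u \<in> {0..t}" "\<And>s. s \<in> {0..t} \<Longrightarrow> x u \<le> x s"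
  proof -
    have "continuous_on {0..t} x" using cont by (rule continuous_on_subset) auto
    then show ?thesis using continuous_attains_inf[of "{0..t}" x] assms(1) that by auto
  qed
  obtain k :: nat where "1 / Suc k < x u - c"
    using above[of u] u(1) nat_approx_posE[of "x u - c"] by auto
  moreover obtain q where "q \<in> {0..t}" "x q < c + 1 / Suc k" using * by blast
  ultimately show False using u(2)[of q] by auto
qed

lemma above_before_first_passage:
  fixes t c :: real
  assumes "0 \<le> K" "0 \<le> t" "t < first_passage x c K"
  shows "c < x t"
  using assms passed_below_if_le[of t c] first_passage_le_iff[of K x c t] by fastforce

text \<open>At the passage time itself the bound is a limit from the left. \<open>pos\<close>
  excludes paths that start at or below \<open>c\<close>: their passage time is 0 and nothing bounds
  \<open>x 0\<close> from below.\<close>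

lemma ge_until_first_passage:
  assumes K: "0 \<le> K" and t: "0 \<le> t" "t \<le> first_passage x c K" and pos: "0 < first_passage x c K"
  shows "c \<le> x t"
proof (cases "t < first_passage x c K")
  case True
  then show ?thesis using above_before_first_passage[OF K t(1) True] by simp
next
  case False
  then have t': "t = first_passage x c K" "0 < t" using t pos by auto
  have "(x \<longlongrightarrow> x t) (at t within {0..<t})"
    using cont t by (auto simp: continuous_on_def intro: tendsto_within_subset)
  moreover have "\<forall>\<^sub>F s in at t within {0..<t}. c \<le> x s"
    using above_before_first_passage[OF K] t' by (auto simp: eventually_at_filter intro!: always_eventually less_imp_le)
  moreover have "at t within {0..<t} \<noteq> bot"
    using t' by (simp add: at_within_eq_bot_iff trivial_limit_within islimpt_Ico)
  ultimately show ?thesis by (intro tendsto_lowerbound) auto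
qed

end

context filtered_prob_space
begin

lemma pred_passed_below:
  assumes X: "\<And>t. 0 \<le> t \<Longrightarrow> X t \<in> borel_measurable (F t)" and t: "0 \<le> t"
  shows "Measurable.pred (F t) (\<lambda>\<omega>. passed_below (\<lambda>s. X s \<omega>) c t)"
proof -
  have m: "X q \<in> borel_measurable (F t)" if "0 \<le> q" "q \<le> t" for q
    using that measurable_F_mono[OF X] by auto
  have c: "countable (\<rat> \<inter> A)" for A :: "real set" using countable_rat by (rule countable_Int1)
  show ?thesis
    unfolding passed_below_def rationally_uniformly_continuous_def
  proof (intro pred_intros_logic pred_intros_countable measurable_pred_countable c)
    show "Measurable.pred (F t) (\<lambda>\<omega>. X 0 \<omega> \<le> c)" using m[of 0] t by measurable
  next
    fix k r j p q
    assume "r \<in> \<rat> \<inter> {0<..<t}" "p \<in> \<rat> \<inter> {0..r}" "q \<in> \<rat> \<inter> {0..r}"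
    then have [measurable]: "X p \<in> borel_measurable (F t)" "X q \<in> borel_measurable (F t)"
      by (auto intro: m)
    show "Measurable.pred (F t) (\<lambda>\<omega>. \<bar>X p \<omega> - X q \<omega>\<bar> < 1 / real (Suc k))" by measurable
  next
    show "Measurable.pred (F t) (\<lambda>\<omega>. \<bar>p - q\<bar> < 1 / real (Suc m))" for p q :: real and m :: nat
      by simp
  next
    fix k r q
    assume "r \<in> \<rat> \<inter> {0<..<t}" "q \<in> \<rat> \<inter> {0..<r}"
    then have [measurable]: "X q \<in> borel_measurable (F t)" by (auto intro: m)
    show "Measurable.pred (F t) (\<lambda>\<omega>. X q \<omega> < c + 1 / real (Suc k))" by measurable
  qed
qed

lemma stopping_time_first_passage:
  assumes X: "\<And>t. 0 \<le> t \<Longrightarrow> X t \<in> borel_measurable (F t)" and K: "0 \<le> K"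
  shows "stopping_time F (\<lambda>\<omega>. first_passage (\<lambda>s. X s \<omega>) c K)"
  unfolding stopping_time_def first_passage_le_iff[OF K]
proof
  fix t
  show "Measurable.pred (F t) (\<lambda>\<omega>. 0 \<le> t \<and> (K \<le> t \<or> passed_below (\<lambda>s. X s \<omega>) c t))"
    using pred_passed_below[OF X] by (cases "0 \<le> t") auto
qed

end

section \<open>Approximation by times with finitely many values\<close>

text \<open>\<open>T\<close> is rounded up to the grid of mesh \<open>1 / (k + 1)\<close> and then
  capped at \<open>t\<close>. Rounding up preserves stopping times.\<close>

definition grid_time :: "nat \<Rightarrow> real \<Rightarrow> real \<Rightarrow> real" where
  "grid_time k t T = min t (\<lceil>(real k + 1) * T\<rceil> / (real k + 1))"

lemma grid_time_bounds:
  "min t T \<le> grid_time k t T" "grid_time k t T \<le> t" "grid_time k t T \<le> min t T + 1 / (real k + 1)"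
proof -
  have "T \<le> \<lceil>(real k + 1) * T\<rceil> / (real k + 1)"
    by (simp add: le_divide_eq mult.commute)
  moreover have "\<lceil>(real k + 1) * T\<rceil> / (real k + 1) \<le> T + 1 / (real k + 1)"
  proof -
    have "real_of_int \<lceil>(real k + 1) * T\<rceil> \<le> (real k + 1) * T + 1" by linarith
    then have "\<lceil>(real k + 1) * T\<rceil> / (real k + 1) \<le> ((real k + 1) * T + 1) / (real k + 1)"
      by (intro divide_right_mono) auto
    also have "\<dots> = T + 1 / (real k + 1)" by (simp add: field_simps)
    finally show ?thesis .
  qed
  moreover have "0 \<le> 1 / (real k + 1)" by simp
  ultimately show "min t T \<le> grid_time k t T" "grid_time k t T \<le> t"
    "grid_time k t T \<le> min t T + 1 / (real k + 1)"
    unfolding grid_time_def by linarith+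
qed

lemma grid_time_tendsto: "(\<lambda>k. grid_time k t T) \<longlonglongrightarrow> min t T"
proof (rule tendsto_sandwich[OF _ _ tendsto_const])
  have "(\<lambda>k. min t T + 1 / (real k + 1)) \<longlonglongrightarrow> min t T + 0"
    using LIMSEQ_Suc[OF lim_inverse_n'] by (intro tendsto_add tendsto_const) (simp add: add.commute)
  then show "(\<lambda>k. min t T + 1 / (real k + 1)) \<longlonglongrightarrow> min t T" by simp
qed (intro always_eventually allI grid_time_bounds)+

text \<open>The rounded time is at most \<open>u\<close> exactly when \<open>T\<close> is at most
  the last grid point before or at \<open>u\<close>, which is known by time
  \<open>u\<close>.\<close>

lemma grid_time_le_iff:
  "grid_time k t T \<le> u \<longleftrightarrow> t \<le> u \<or> T \<le> \<lfloor>(real k + 1) * u\<rfloor> / (real k + 1)"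
proof -
  have "\<lceil>(real k + 1) * T\<rceil> / (real k + 1) \<le> u \<longleftrightarrow> real_of_int \<lceil>(real k + 1) * T\<rceil> \<le> (real k + 1) * u"
    by (simp add: divide_le_eq mult.commute)
  also have "\<dots> \<longleftrightarrow> (real k + 1) * T \<le> real_of_int \<lfloor>(real k + 1) * u\<rfloor>"
    by (simp add: le_floor_iff[symmetric] ceiling_le_iff)
  also have "\<dots> \<longleftrightarrow> T \<le> \<lfloor>(real k + 1) * u\<rfloor> / (real k + 1)"
    by (simp add: le_divide_eq mult.commute)
  finally show ?thesis unfolding grid_time_def by (simp add: min_le_iff_disj)
qed

lemma grid_time_range:
  assumes "0 \<le> T" "T \<le> K"
  shows "grid_time k t T \<in> (\<lambda>j::nat. min t (j / (real k + 1))) ` {..nat \<lceil>(real k + 1) * K\<rceil>}"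
proof (rule image_eqI)
  have "0 \<le> \<lceil>(real k + 1) * T\<rceil>" using assms by (simp add: le_ceiling_iff order_less_le_trans[of _ 0])
  then show "grid_time k t T = min t (real (nat \<lceil>(real k + 1) * T\<rceil>) / (real k + 1))"
    by (simp add: grid_time_def)
  have "(real k + 1) * T \<le> (real k + 1) * K" using assms by (intro mult_left_mono) auto
  then show "nat \<lceil>(real k + 1) * T\<rceil> \<in> {..nat \<lceil>(real k + 1) * K\<rceil>}"
    unfolding atMost_iff by (intro nat_mono ceiling_mono)
qed

context filtered_prob_space
begin

lemma stopping_time_grid_time:
  assumes T: "stopping_time F T"
  shows "stopping_time F (\<lambda>\<omega>. grid_time k t (T \<omega>))"
  unfolding stopping_time_def grid_time_le_iff
proof
  fix u
  have "real_of_int \<lfloor>(real k + 1) * u\<rfloor> / (real k + 1) \<le> u"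
    by (simp add: divide_le_eq mult.commute)
  then show "Measurable.pred (F u) (\<lambda>\<omega>. t \<le> u \<or> T \<omega> \<le> \<lfloor>(real k + 1) * u\<rfloor> / (real k + 1))"
    using stopping_time_le_const[OF T] by (intro pred_intros_logic) auto
qed

lemma measurable_at_finite_stopping_time:
  fixes X :: "real \<Rightarrow> 'a \<Rightarrow> real"
  assumes X: "\<And>r. r \<in> V \<Longrightarrow> X r \<in> borel_measurable (F r)" and R: "stopping_time F R"
    and V: "finite V" "\<And>r. r \<in> V \<Longrightarrow> r \<le> t" "\<And>\<omega>. \<omega> \<in> space M \<Longrightarrow> R \<omega> \<in> V"
  shows "(\<lambda>\<omega>. X (R \<omega>) \<omega>) \<in> borel_measurable (F t)"
proof -
  have [measurable]: "X r \<in> borel_measurable (F t)" "{\<omega>\<in>space M. R \<omega> = r} \<in> sets (F t)"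
    if "r \<in> V" for r
    using that measurable_F_mono[OF X] V(2) sets_F_mono[OF V(2)[OF that]] stopping_time_eq_const[OF R, of r]
    by (auto simp: pred_def space_F)
  have "(\<lambda>\<omega>. \<Sum>r\<in>V. indicator {\<omega>\<in>space M. R \<omega> = r} \<omega> * X r \<omega>) \<in> borel_measurable (F t)"
    by (intro borel_measurable_sum borel_measurable_times borel_measurable_indicator) auto
  also have "?this \<longleftrightarrow> ?thesis"
  proof (rule measurable_cong)
    fix \<omega> assume w: "\<omega> \<in> space (F t)"
    have "(\<Sum>r\<in>V. indicator {\<omega>\<in>space M. R \<omega> = r} \<omega> * X r \<omega>) = (\<Sum>r\<in>V. if r = R \<omega> then X (R \<omega>) \<omega> else 0)"
      using w by (intro sum.cong) (auto simp: space_F indicator_def)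
    then show "(\<Sum>r\<in>V. indicator {\<omega>\<in>space M. R \<omega> = r} \<omega> * X r \<omega>) = X (R \<omega>) \<omega>"
      using V w by (simp add: space_F)
  qed
  finally show ?thesis .
qed

end

section \<open>Localization of \<open>N\<close> under P\<close>

context density_martingale
begin

text \<open>Splitting by the value \<open>r\<close> of \<open>R\<close> reduces everything to fixed
  times. The condition on \<open>C\<close> says that \<open>C\<close> is decided by time
  \<open>R\<close>, and \<open>D\<close> is so by construction, hence each piece \<open>E r\<close>
  lies in \<open>F r\<close>.\<close>

lemma set_integral_N_finite_stopping_time:
  assumes R: "stopping_time F R"
    and V: "finite V" "V \<subseteq> {0..t}" "\<And>\<omega>. \<omega> \<in> space Q \<Longrightarrow> R \<omega> \<in> V"
    and C: "\<And>r. r \<in> V \<Longrightarrow> C \<inter> {\<omega>\<in>space Q. R \<omega> = r} \<in> sets (F r)" "C \<subseteq> space Q"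
    and b: "0 \<le> b"
    and D: "D = {\<omega>\<in>space Q. \<bar>f (R \<omega>) \<omega>\<bar> \<le> a \<and> b < h (R \<omega>) \<omega>}"
  shows "C \<inter> D \<in> sets (F t)"
    and "(\<integral>\<omega>\<in>C \<inter> D. N (R \<omega>) \<omega> \<partial>P) = (\<integral>\<omega>\<in>C \<inter> D. f t \<omega> \<partial>Q)"
proof -
  define E where "E r = C \<inter> {\<omega>\<in>space Q. R \<omega> = r} \<inter> {\<omega>\<in>space Q. \<bar>f r \<omega>\<bar> \<le> a \<and> b < h r \<omega>}" for r
  have E: "E r \<in> sets (F r)" if "r \<in> V" for r
  proof -
    have [measurable]: "f r \<in> borel_measurable (F r)" "h r \<in> borel_measurable (F r)"
      using that V f_adapted h_adapted by auto
    have "{\<omega>\<in>space (F r). \<bar>f r \<omega>\<bar> \<le> a \<and> b < h r \<omega>} \<in> sets (F r)" by measurable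
    then show ?thesis unfolding E_def using C that by (auto simp: Q.space_F)
  qed
  have Et: "E r \<in> sets (F t)" if "r \<in> V" for r
    using subsetD[OF Q.sets_F_mono E[OF that]] that V(2) by auto
  note EQ = Q.sets_F_imp[OF E] and EP = P.sets_F_imp[OF E]
  have U: "C \<inter> D = (\<Union>r\<in>V. E r)"
    using C(2) V(3) unfolding D E_def by auto
  show "C \<inter> D \<in> sets (F t)"
    unfolding U using V Et by (intro sets.finite_UN) auto
  have disj: "disjoint_family_on E V" by (auto simp: disjoint_family_on_def E_def)
  have eq: "(\<integral>\<omega>\<in>E r. N (R \<omega>) \<omega> \<partial>P) = (\<integral>\<omega>\<in>E r. f t \<omega> \<partial>Q)" if r: "r \<in> V" for r
  proof -
    have "(\<integral>\<omega>\<in>E r. N (R \<omega>) \<omega> \<partial>P) = (\<integral>\<omega>\<in>E r. N r \<omega> \<partial>P)"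
      using EP[OF r] by (intro set_lebesgue_integral_cong) (auto simp: E_def)
    also have "\<dots> = (\<integral>\<omega>\<in>E r \<inter> {\<omega>. h r \<omega> \<noteq> 0}. f r \<omega> \<partial>Q)"
      using r V by (intro set_integral_N E) auto
    \<comment> \<open>\<open>b < h r\<close> with \<open>b \<ge> 0\<close> removes the cut-off, so
      \<open>f r\<close> is integrated over an event of \<open>F r\<close> and can be replaced by
      \<open>f t\<close>.\<close>
    also have "E r \<inter> {\<omega>. h r \<omega> \<noteq> 0} = E r" using b by (auto simp: E_def)
    also have "(\<integral>\<omega>\<in>E r. f r \<omega> \<partial>Q) = (\<integral>\<omega>\<in>E r. f t \<omega> \<partial>Q)"
      using r V by (intro f_set_integral[symmetric] E) auto
    finally show ?thesis .
  qed
  have "(\<integral>\<omega>\<in>C \<inter> D. N (R \<omega>) \<omega> \<partial>P) = (\<Sum>r\<in>V. \<integral>\<omega>\<in>E r. N (R \<omega>) \<omega> \<partial>P)"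
    unfolding U
  proof (rule set_integral_finite_Union[OF V(1) disj])
    fix r assume r: "r \<in> V"
    have "integrable P (\<lambda>\<omega>. indicator (E r) \<omega> *\<^sub>R N r \<omega>)"
      using EP[OF r] N_integrable[of r] r V by (intro integrable_mult_indicator) auto
    then show "set_integrable P (E r) (\<lambda>\<omega>. N (R \<omega>) \<omega>)"
      unfolding set_integrable_def
      by (rule Bochner_Integration.integrable_cong[THEN iffD1, rotated 2]) (auto simp: E_def indicator_def)
  qed (rule EP)
  also have "\<dots> = (\<Sum>r\<in>V. \<integral>\<omega>\<in>E r. f t \<omega> \<partial>Q)" by (intro sum.cong refl eq)
  also have "\<dots> = (\<integral>\<omega>\<in>C \<inter> D. f t \<omega> \<partial>Q)"
    unfolding U
  proof (rule set_integral_finite_Union[OF V(1) disj, symmetric])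
    fix r assume r: "r \<in> V"
    then show "set_integrable Q (E r) (f t)"
      unfolding set_integrable_def using EQ[OF r] f_integrable[of t] V
      by (intro integrable_mult_indicator) auto
  qed (rule EQ)
  finally show "(\<integral>\<omega>\<in>C \<inter> D. N (R \<omega>) \<omega> \<partial>P) = (\<integral>\<omega>\<in>C \<inter> D. f t \<omega> \<partial>Q)" .
qed

text \<open>
  As long as this process stays above c > 0, the density is at least c and f is bounded by 1 / c,
  so that N is bounded.
\<close>

definition safety :: "real \<Rightarrow> 'a \<Rightarrow> real" where
  "safety t \<omega> = min (h t \<omega>) (1 / (1 + \<bar>f t \<omega>\<bar>))"

definition continuous_paths :: "'a \<Rightarrow> bool" where
  "continuous_paths \<omega> \<longleftrightarrow> continuous_on {0..} (\<lambda>t. h t \<omega>) \<and> continuous_on {0..} (\<lambda>t. f t \<omega>)"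

lemma AE_continuous_paths: "AE \<omega> in Q. continuous_paths \<omega>" "AE \<omega> in P. continuous_paths \<omega>"
  using Q.as_continuous_AE[OF h_cont] Q.as_continuous_AE[OF f_cont]
    as_continuous_AE_P[OF h_cont] as_continuous_AE_P[OF f_cont]
  unfolding continuous_paths_def by auto

lemma safety_adapted: "0 \<le> t \<Longrightarrow> safety t \<in> borel_measurable (F t)"
  unfolding safety_def[abs_def] using f_adapted[of t] h_adapted[of t] by measurable

lemma safety_continuous: "continuous_paths \<omega> \<Longrightarrow> continuous_on {0..} (\<lambda>t. safety t \<omega>)"
  unfolding continuous_paths_def safety_def
  by (intro continuous_on_min continuous_on_divide continuous_on_add continuous_on_const
      continuous_on_rabs) (auto simp: add_pos_nonneg add_nonneg_eq_0_iff)

lemma le_safetyD: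
  assumes "0 < c" "c \<le> safety t \<omega>"
  shows "c \<le> h t \<omega>" "\<bar>f t \<omega>\<bar> < 1 / c"
proof -
  show "c \<le> h t \<omega>" using assms by (simp add: safety_def)
  have "c \<le> 1 / (1 + \<bar>f t \<omega>\<bar>)" using assms by (simp add: safety_def)
  then have "1 + \<bar>f t \<omega>\<bar> \<le> 1 / c" using assms(1) by (simp add: field_simps add_pos_nonneg)
  then show "\<bar>f t \<omega>\<bar> < 1 / c" by simp
qed

context
  fixes c K :: real
  assumes c: "0 < c" and K: "0 \<le> K"
begin

definition exit_time :: "'a \<Rightarrow> real" where
  "exit_time \<omega> = first_passage (\<lambda>t. safety t \<omega>) c K"

lemma exit_time_stopping_time: "stopping_time F exit_time"
  unfolding exit_time_def[abs_def] by (rule Q.stopping_time_first_passage[OF safety_adapted K])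

lemma exit_time_range: "0 \<le> exit_time \<omega>" "exit_time \<omega> \<le> K"
  unfolding exit_time_def using K by (auto intro: first_passage_nonneg simp: first_passage_le_iff)

lemma before_exit_time:
  assumes "continuous_paths \<omega>" "0 < exit_time \<omega>" "0 \<le> t"
  shows "c \<le> h (min t (exit_time \<omega>)) \<omega>" "\<bar>f (min t (exit_time \<omega>)) \<omega>\<bar> < 1 / c"
proof -
  have "c \<le> safety (min t (exit_time \<omega>)) \<omega>"
    using ge_until_first_passage[OF safety_continuous[OF assms(1)] K, of "min t (exit_time \<omega>)" c] assms
    by (auto simp: exit_time_def)
  then show "c \<le> h (min t (exit_time \<omega>)) \<omega>" "\<bar>f (min t (exit_time \<omega>)) \<omega>\<bar> < 1 / c"
    using le_safetyD[OF c] by auto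
qed

abbreviation grid :: "nat \<Rightarrow> real \<Rightarrow> 'a \<Rightarrow> real" where
  "grid k t \<omega> \<equiv> grid_time k t (exit_time \<omega>)"

lemma tendsto_at_grid:
  assumes cont: "continuous_on {0..} (\<lambda>t. X t \<omega>)" and t: "0 \<le> t"
  shows "(\<lambda>k. X (grid k t \<omega>) \<omega>) \<longlonglongrightarrow> X (min t (exit_time \<omega>)) \<omega>"
proof (rule continuous_on_tendsto_compose[OF cont grid_time_tendsto])
  show "min t (exit_time \<omega>) \<in> {0..}" using t exit_time_range by simp
  show "\<forall>\<^sub>F k in sequentially. grid k t \<omega> \<in> {0..}"
  proof (rule always_eventually, rule allI)
    fix k show "grid k t \<omega> \<in> {0..}"
      using t exit_time_range(1)[of \<omega>] grid_time_bounds(1)[of t "exit_time \<omega>" k] by simp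
  qed
qed

lemma N_at_grid_tendsto:
  assumes w: "continuous_paths \<omega>" and t: "0 \<le> t"
  shows "(\<lambda>k. N (grid k t \<omega>) \<omega>) \<longlonglongrightarrow> N (min t (exit_time \<omega>)) \<omega>"
proof (cases "exit_time \<omega> = 0")
  \<comment> \<open>Here \<open>h\<close> may be arbitrarily small at the start, but all grid times
    are 0 and the sequence is constant.\<close>
  case True
  then show ?thesis using t by (simp add: grid_time_def)
next
  case False
  then have "0 < exit_time \<omega>" using exit_time_range(1)[of \<omega>] by simp
  then have "h (min t (exit_time \<omega>)) \<omega> \<noteq> 0" using before_exit_time(1)[OF w _ t] c by simp
  then show ?thesis
    unfolding N_def using w t by (intro tendsto_divide tendsto_at_grid) (auto simp: continuous_paths_def)
qed

text \<open>
  The stopped process itself need not be adapted to the raw filtration on paths that are not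
  continuous; the limit along the grid times, which are stopping times with finitely many values, is.
\<close>

definition stopped_N :: "real \<Rightarrow> 'a \<Rightarrow> real" where
  "stopped_N t \<omega> = lim (\<lambda>k. N (grid k t \<omega>) \<omega>)"

lemma stopped_N_eq: "continuous_paths \<omega> \<Longrightarrow> 0 \<le> t \<Longrightarrow> stopped_N t \<omega> = N (min t (exit_time \<omega>)) \<omega>"
  unfolding stopped_N_def by (rule limI[OF N_at_grid_tendsto])

definition grid_values :: "nat \<Rightarrow> real \<Rightarrow> real set" where
  "grid_values k t = (\<lambda>j::nat. min t (j / (real k + 1))) ` {..nat \<lceil>(real k + 1) * K\<rceil>}"

lemma grid_values:
  "finite (grid_values k t)" "0 \<le> t \<Longrightarrow> grid_values k t \<subseteq> {0..t}" "grid k t \<omega> \<in> grid_values k t"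
  unfolding grid_values_def by (simp, force, rule grid_time_range[OF exit_time_range])

lemma grid_stopping_time: "stopping_time F (grid k t)"
  by (rule Q.stopping_time_grid_time[OF exit_time_stopping_time])

lemma at_grid_measurable:
  assumes "\<And>r. 0 \<le> r \<Longrightarrow> X r \<in> borel_measurable (F r)" "0 \<le> t"
  shows "(\<lambda>\<omega>. X (grid k t \<omega>) \<omega> :: real) \<in> borel_measurable (F t)"
proof (rule Q.measurable_at_finite_stopping_time[OF _ grid_stopping_time grid_values(1) _ grid_values(3)])
  fix r assume "r \<in> grid_values k t"
  then have r: "r \<in> {0..t}" using grid_values(2)[OF assms(2)] by blast
  then show "X r \<in> borel_measurable (F r)" using assms(1) by simp
  show "r \<le> t" using r by simp
qed

lemma stopped_N_adapted: "0 \<le> t \<Longrightarrow> stopped_N t \<in> borel_measurable (F t)"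
  unfolding stopped_N_def[abs_def]
  by (rule borel_measurable_lim_metric) (rule at_grid_measurable[OF N_adapted])

text \<open>Paths that exit at time 0 are frozen at \<open>N 0\<close>, which no constant bounds,
  hence the first summand of the dominating function; on all others \<open>1 / c / c\<close> bounds
  \<open>N\<close>.\<close>

lemma stopped_N_integrable:
  assumes t: "0 \<le> t"
  shows "integrable P (stopped_N t)"
proof (rule Bochner_Integration.integrable_bound)
  show "integrable P (\<lambda>\<omega>. \<bar>N 0 \<omega>\<bar> + 1 / c / c)"
    using N_integrable[of 0] by auto
  show "stopped_N t \<in> borel_measurable P" by (rule P.measurable_F_imp[OF stopped_N_adapted[OF t]])
  show "AE \<omega> in P. norm (stopped_N t \<omega>) \<le> norm (\<bar>N 0 \<omega>\<bar> + 1 / c / c)"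
    using AE_continuous_paths(2)
  proof eventually_elim
    case (elim \<omega>)
    show ?case
    proof (cases "exit_time \<omega> = 0")
      case True
      then show ?thesis using stopped_N_eq[OF elim t] t c by simp
    next
      case False
      then have "0 < exit_time \<omega>" using exit_time_range(1)[of \<omega>] by simp
      note b = before_exit_time[OF elim this t]
      have "\<bar>N (min t (exit_time \<omega>)) \<omega>\<bar> \<le> 1 / c / c"
        unfolding N_def abs_divide using b c by (intro frac_le) auto
      then show ?thesis using stopped_N_eq[OF elim t] c by simp
    qed
  qed
qed

text \<open>
  No uniform integrability of f at the grid times is needed: on the event D k both h and f are
  controlled at the grid time, the value of f there may be replaced by f t because the event is
  decided by that time, and the events D k exhaust C by path continuity.
\<close>

lemma set_integral_stopped_N:
  assumes st: "0 \<le> s" "s \<le> t" and C: "C \<in> sets (F s)" "\<And>\<omega>. \<omega> \<in> C \<Longrightarrow> s < exit_time \<omega>"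
  shows "(\<integral>\<omega>\<in>C. stopped_N t \<omega> \<partial>P) = (\<integral>\<omega>\<in>C. f t \<omega> \<partial>Q)"
proof -
  have t: "0 \<le> t" using st by simp
  \<comment> \<open>At the limit time \<open>h\<close> is at least \<open>c\<close> and
    \<open>f\<close> is strictly below \<open>1 / c\<close> in absolute value. Halving
    \<open>c\<close> makes the first bound strict too, so both persist along the grid, and on
    \<open>D k\<close> they give the dominating constant \<open>(1 / c) / (c / 2)\<close>.\<close>
  define D where "D k = {\<omega>\<in>space Q. \<bar>f (grid k t \<omega>) \<omega>\<bar> \<le> 1 / c \<and> c / 2 < h (grid k t \<omega>) \<omega>}" for k
  have CS: "C \<subseteq> space Q" using sets.sets_into_space[OF C(1)] by (simp add: Q.space_F)
  have Cr: "C \<inter> {\<omega>\<in>space Q. grid k t \<omega> = r} \<in> sets (F r)" for k r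
  proof (cases "s \<le> r")
    case True
    then show ?thesis
      using C(1) Q.sets_F_mono[OF True] Q.stopping_time_eq_const[OF grid_stopping_time[of k t], of r]
      by (auto simp: pred_def Q.space_F)
  next
    case False
    \<comment> \<open>On \<open>C\<close> the exit comes after \<open>s\<close>, and grid times
      round up, so no grid time falls before \<open>s\<close>.\<close>
    have "r < grid k t \<omega>" if "\<omega> \<in> C" for \<omega>
      using C(2)[OF that] grid_time_bounds(1)[of t "exit_time \<omega>" k] st False by simp
    then have "C \<inter> {\<omega>\<in>space Q. grid k t \<omega> = r} = {}" by auto
    then show ?thesis by simp
  qed
  note step = set_integral_N_finite_stopping_time[OF grid_stopping_time grid_values(1)
      grid_values(2)[OF t] grid_values(3) Cr CS _ D_def]
  have CD: "C \<inter> D k \<in> sets (F t)" for k using step(1)[of k] c by simp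
  have eq: "(\<integral>\<omega>\<in>C \<inter> D k. N (grid k t \<omega>) \<omega> \<partial>P) = (\<integral>\<omega>\<in>C \<inter> D k. f t \<omega> \<partial>Q)" for k
    using step(2)[of k] c by simp
  have inD: "\<forall>\<^sub>F k in sequentially. \<omega> \<in> C \<inter> D k" if w: "continuous_paths \<omega>" "\<omega> \<in> C" for \<omega>
  proof -
    have "0 < exit_time \<omega>" using C(2)[OF w(2)] st by simp
    note b = before_exit_time[OF w(1) this t]
    have "(\<lambda>k. h (grid k t \<omega>) \<omega>) \<longlonglongrightarrow> h (min t (exit_time \<omega>)) \<omega>"
      "(\<lambda>k. \<bar>f (grid k t \<omega>) \<omega>\<bar>) \<longlonglongrightarrow> \<bar>f (min t (exit_time \<omega>)) \<omega>\<bar>"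
      using w(1) t by (auto intro!: tendsto_rabs tendsto_at_grid simp: continuous_paths_def)
    then have "\<forall>\<^sub>F k in sequentially. c / 2 < h (grid k t \<omega>) \<omega>"
        "\<forall>\<^sub>F k in sequentially. \<bar>f (grid k t \<omega>) \<omega>\<bar> < 1 / c"
      using b c by (auto elim!: order_tendstoD simp del: divide_less_eq_numeral1)
    then show ?thesis
      by eventually_elim (use w(2) CS in \<open>auto simp: D_def\<close>)
  qed
  have ind: "(\<lambda>k. indicat_real (C \<inter> D k) \<omega>) \<longlonglongrightarrow> indicat_real C \<omega>" if w: "continuous_paths \<omega>" for \<omega>
  proof (cases "\<omega> \<in> C")
    case True
    then show ?thesis
      using inD[OF w True] by (intro tendsto_eventually) (auto elim: eventually_mono)
  qed simp
  have [measurable]: "C \<in> sets P" "C \<in> sets Q" "C \<inter> D k \<in> sets P" "C \<inter> D k \<in> sets Q" for k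
    using P.sets_F_imp[OF CD] Q.sets_F_imp[OF CD] P.sets_F_imp[OF C(1)] Q.sets_F_imp[OF C(1)] by auto
  have [measurable]: "(\<lambda>\<omega>. N (grid k t \<omega>) \<omega>) \<in> borel_measurable P" for k
    by (rule P.measurable_F_imp[OF at_grid_measurable[OF N_adapted t]])
  have [measurable]: "stopped_N t \<in> borel_measurable P" "f t \<in> borel_measurable Q"
    by (rule P.measurable_F_imp[OF stopped_N_adapted[OF t]] Q.measurable_F_imp[OF f_adapted[OF t]])+
  have "(\<lambda>k. \<integral>\<omega>\<in>C \<inter> D k. N (grid k t \<omega>) \<omega> \<partial>P) \<longlonglongrightarrow> (\<integral>\<omega>\<in>C. stopped_N t \<omega> \<partial>P)"
    unfolding set_lebesgue_integral_def
  proof (rule integral_dominated_convergence[where w="\<lambda>_. (1 / c) / (c / 2)"])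
    show "AE \<omega> in P. (\<lambda>k. indicat_real (C \<inter> D k) \<omega> *\<^sub>R N (grid k t \<omega>) \<omega>)
        \<longlonglongrightarrow> indicat_real C \<omega> *\<^sub>R stopped_N t \<omega>"
      using AE_continuous_paths(2)
    proof eventually_elim
      case (elim \<omega>)
      then show ?case
        using N_at_grid_tendsto[OF elim t] stopped_N_eq[OF elim t] by (intro tendsto_scaleR ind) auto
    qed
    show "AE \<omega> in P. norm (indicat_real (C \<inter> D k) \<omega> *\<^sub>R N (grid k t \<omega>) \<omega>) \<le> (1 / c) / (c / 2)" for k
    proof (rule AE_I2)
      fix \<omega>
      show "norm (indicat_real (C \<inter> D k) \<omega> *\<^sub>R N (grid k t \<omega>) \<omega>) \<le> (1 / c) / (c / 2)"
      proof (cases "\<omega> \<in> C \<inter> D k")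
        case True
        then have "\<bar>N (grid k t \<omega>) \<omega>\<bar> \<le> (1 / c) / (c / 2)"
          unfolding N_def abs_divide using c by (intro frac_le) (auto simp: D_def)
        then show ?thesis using True by simp
      qed (use c in simp)
    qed
  qed auto
  moreover have "(\<lambda>k. \<integral>\<omega>\<in>C \<inter> D k. f t \<omega> \<partial>Q) \<longlonglongrightarrow> (\<integral>\<omega>\<in>C. f t \<omega> \<partial>Q)"
    unfolding set_lebesgue_integral_def
  proof (rule integral_dominated_convergence[where w="\<lambda>\<omega>. \<bar>f t \<omega>\<bar>"])
    show "AE \<omega> in Q. (\<lambda>k. indicat_real (C \<inter> D k) \<omega> *\<^sub>R f t \<omega>) \<longlonglongrightarrow> indicat_real C \<omega> *\<^sub>R f t \<omega>"
      using AE_continuous_paths(1) by eventually_elim (intro tendsto_scaleR ind tendsto_const)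
    show "AE \<omega> in Q. norm (indicat_real (C \<inter> D k) \<omega> *\<^sub>R f t \<omega>) \<le> \<bar>f t \<omega>\<bar>" for k
      by (simp add: indicator_def)
  qed (use f_integrable[OF t] in \<open>auto simp del: real_scaleR_def\<close>)
  ultimately show ?thesis unfolding eq by (rule LIMSEQ_unique)
qed

text \<open>Split at time \<open>s\<close>: where the exit has not occurred, both sides are
  integrals of \<open>f\<close>, whose martingale property applies; where it has, the stopped
  process no longer moves.\<close>

lemma stopped_N_martingale: "martingale P F stopped_N"
  unfolding P.martingale_iff
proof (intro conjI allI impI ballI stopped_N_adapted stopped_N_integrable)
  fix s t A assume st: "(0::real) \<le> s" "s \<le> t" and A: "A \<in> sets (F s)"
  have t: "0 \<le> t" using st by simp
  let ?A1 = "A \<inter> {\<omega>\<in>space Q. s < exit_time \<omega>}" and ?A2 = "A \<inter> {\<omega>\<in>space Q. exit_time \<omega> \<le> s}"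
  have A1: "?A1 \<in> sets (F s)" and A2: "?A2 \<in> sets (F s)"
    using A stopping_timeD[OF exit_time_stopping_time, of s] stopping_timeD2[OF exit_time_stopping_time, of s]
    by (auto simp: pred_def Q.space_F)
  have AU: "A = ?A1 \<union> ?A2" using sets.sets_into_space[OF A] by (auto simp: Q.space_F)
  have split: "(\<integral>\<omega>\<in>A. stopped_N u \<omega> \<partial>P) = (\<integral>\<omega>\<in>?A1. stopped_N u \<omega> \<partial>P) + (\<integral>\<omega>\<in>?A2. stopped_N u \<omega> \<partial>P)"
    if "0 \<le> u" for u
  proof -
    have "(\<integral>\<omega>\<in>?A1 \<union> ?A2. stopped_N u \<omega> \<partial>P) = (\<integral>\<omega>\<in>?A1. stopped_N u \<omega> \<partial>P) + (\<integral>\<omega>\<in>?A2. stopped_N u \<omega> \<partial>P)"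
      using stopped_N_integrable[OF that] P.sets_F_imp[OF A1] P.sets_F_imp[OF A2]
      by (intro set_integral_Un) (auto simp: set_integrable_def intro!: integrable_mult_indicator simp del: real_scaleR_def)
    then show ?thesis using AU by simp
  qed
  have "(\<integral>\<omega>\<in>?A1. stopped_N t \<omega> \<partial>P) = (\<integral>\<omega>\<in>?A1. f t \<omega> \<partial>Q)"
    by (rule set_integral_stopped_N[OF st A1]) simp
  also have "\<dots> = (\<integral>\<omega>\<in>?A1. f s \<omega> \<partial>Q)" by (rule f_set_integral[OF st A1])
  also have "\<dots> = (\<integral>\<omega>\<in>?A1. stopped_N s \<omega> \<partial>P)"
    by (rule set_integral_stopped_N[OF st(1) order_refl A1, symmetric]) simp
  finally have 1: "(\<integral>\<omega>\<in>?A1. stopped_N t \<omega> \<partial>P) = (\<integral>\<omega>\<in>?A1. stopped_N s \<omega> \<partial>P)" .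
  have "AE \<omega> in P. indicat_real ?A2 \<omega> *\<^sub>R stopped_N t \<omega> = indicat_real ?A2 \<omega> *\<^sub>R stopped_N s \<omega>"
    using AE_continuous_paths(2)
  proof eventually_elim
    case (elim \<omega>)
    show ?case
    proof (cases "\<omega> \<in> ?A2")
      case True
      then have "min t (exit_time \<omega>) = min s (exit_time \<omega>)" using st by auto
      then show ?thesis using stopped_N_eq[OF elim] st t by simp
    qed auto
  qed
  then have 2: "(\<integral>\<omega>\<in>?A2. stopped_N t \<omega> \<partial>P) = (\<integral>\<omega>\<in>?A2. stopped_N s \<omega> \<partial>P)"
    unfolding set_lebesgue_integral_def
    using P.sets_F_imp[OF A2] P.measurable_F_imp[OF stopped_N_adapted[OF st(1)]]
      P.measurable_F_imp[OF stopped_N_adapted[OF t]]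
    by (intro integral_cong_AE borel_measurable_scaleR borel_measurable_indicator) auto
  show "(\<integral>\<omega>\<in>A. stopped_N t \<omega> \<partial>P) = (\<integral>\<omega>\<in>A. stopped_N s \<omega> \<partial>P)"
    using split[OF t] split[OF st(1)] 1 2 by simp
qed

end

text \<open>A value \<open>h t \<le> 0\<close> would by continuity make the path touch zero by every
  integer time \<open>n > t\<close>, which is excluded P-almost surely for all \<open>n\<close> at
  once.\<close>

lemma h_pos_P: "AE \<omega> in P. \<forall>t\<ge>0. 0 < h t \<omega>"
proof -
  have nn: "AE \<omega> in P. \<forall>q\<in>\<rat> \<inter> {0..}. 0 \<le> h q \<omega>"
  proof (rule AE_ball_countable')
    show "countable (\<rat> \<inter> {0::real..})" using countable_rat by (rule countable_Int1)
    fix q :: real assume q: "q \<in> \<rat> \<inter> {0..}"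
    have "{\<omega>\<in>space (F q). 0 \<le> h q \<omega>} \<in> sets (F q)" using h_adapted[of q] q by auto
    then have "AE \<omega> in restr_to_subalg Q (F q). 0 \<le> h q \<omega>"
      using q h_nonneg[of q] Q.subalgebra_F[of q] by (intro AE_restr_to_subalg2) (auto simp: pred_def)
    then show "AE \<omega> in P. 0 \<le> h q \<omega>"
      using q by (intro AE_restr_to_subalg[OF P.subalgebra_F AE_restr_Q_imp_P]) auto
  qed
  show ?thesis
    using nn AE_continuous_paths(2) h_not_touches_zero_P
  proof eventually_elim
    case (elim \<omega>)
    show ?case
    proof (intro allI impI, rule ccontr)
      fix t :: real assume t: "0 \<le> t" and "\<not> 0 < h t \<omega>"
      then have le: "h t \<omega> \<le> 0" by simp
      obtain n :: nat where n: "t < n" using reals_Archimedean2 by blast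
      have "touches_zero h n \<omega>"
        using elim(2) t n le
        by (intro continuous_zero_imp_touches_zero[of h \<omega> t]) (auto simp: continuous_paths_def)
      then show False using elim(3) by auto
    qed
  qed
qed

theorem N_local_martingale: "local_martingale P F N"
  unfolding local_martingale_def
proof (intro conjI allI impI exI)
  \<comment> \<open>The level falls to 0 while the cap grows, so the times increase and both reasons
    for an early exit disappear.\<close>
  define T where "T n = exit_time (1 / Suc n) (real n)" for n
  have c: "0 < 1 / real (Suc n)" and K: "0 \<le> real n" for n by auto
  show "N t \<in> borel_measurable (F t)" if "0 \<le> t" for t using that by (rule N_adapted)
  show "stopping_time F (T n)" for n
    unfolding T_def by (rule exit_time_stopping_time[OF c K])
  show "\<forall>\<omega>\<in>space P. 0 \<le> T n \<omega>" for n
    unfolding T_def using exit_time_range(1)[OF c K] by simp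
  show "martingale P F (stopped_N (1 / Suc n) (real n))" for n
    by (rule stopped_N_martingale[OF c K])
  show "AE \<omega> in P. \<forall>t\<ge>0. N (min t (T n \<omega>)) \<omega> = stopped_N (1 / Suc n) (real n) t \<omega>" for n
    using AE_continuous_paths(2) unfolding T_def
    by eventually_elim (intro allI impI stopped_N_eq[OF c K, symmetric])
  show "AE \<omega> in P. incseq (\<lambda>n. T n \<omega>) \<and> filterlim (\<lambda>n. T n \<omega>) at_top sequentially"
    using AE_continuous_paths(2) h_pos_P
  proof eventually_elim
    case (elim \<omega>)
    have "incseq (\<lambda>n. T n \<omega>)"
      unfolding T_def exit_time_def[OF c K]
      by (intro incseq_SucI first_passage_mono) (auto simp: field_simps)
    moreover have "\<forall>\<^sub>F n in sequentially. Z \<le> T n \<omega>" for Z :: real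
    proof -
      define z where "z = max Z 0"
      have cont: "continuous_on {0..} (\<lambda>t. safety t \<omega>)" by (rule safety_continuous[OF elim(1)])
      then have "continuous_on {0..z} (\<lambda>t. safety t \<omega>)" by (rule continuous_on_subset) auto
      \<comment> \<open>The minimum of \<open>safety\<close> on \<open>{0..z}\<close> is positive
        because \<open>h\<close> is; once \<open>1 / Suc n\<close> is below it and
        \<open>n > z\<close>, the exit comes no earlier than \<open>z\<close>.\<close>
      then obtain u where u: "0 \<le> u" "\<And>s. 0 \<le> s \<Longrightarrow> s \<le> z \<Longrightarrow> safety u \<omega> \<le> safety s \<omega>"
        using continuous_attains_inf[of "{0..z}" "\<lambda>t. safety t \<omega>"] by (auto simp: z_def)
      have "0 < safety u \<omega>" using elim(2) u(1) by (simp add: safety_def add_pos_nonneg)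
      then obtain m :: nat where m: "1 / Suc m < safety u \<omega>" using nat_approx_posE by blast
      obtain l :: nat where l: "z < l" using reals_Archimedean2 by blast
      have "Z \<le> T n \<omega>" if "max m l \<le> n" for n
      proof -
        have "1 / real (Suc n) \<le> 1 / Suc m" using that by (intro divide_left_mono) auto
        then have "z \<le> T n \<omega>"
          unfolding T_def exit_time_def[OF c K]
          using u(2) m l that by (intro le_first_passage[OF cont]) (fastforce simp: z_def)+
        then show ?thesis by (simp add: z_def)
      qed
      then show ?thesis unfolding eventually_sequentially by blast
    qed
    ultimately show ?case by (simp add: filterlim_at_top)
  qed
qed

end

section \<open>Strictness, and the case of a true martingale\<close>

text \<open>Without a zero up to \<open>t\<close>, continuity at \<open>t\<close> extends the
  zero-free interval beyond \<open>t\<close>, so the infimum would exceed \<open>t\<close>.\<close>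

lemma hitting_zero_le_imp_zero:
  assumes cont: "continuous_on {0..} (\<lambda>t. X t \<omega>)" and t: "0 \<le> t"
    and le: "hitting_zero X \<omega> \<le> ereal t"
  shows "\<exists>s. 0 \<le> s \<and> s \<le> t \<and> X s \<omega> = 0"
proof (rule ccontr)
  assume no: "\<nexists>s. 0 \<le> s \<and> s \<le> t \<and> X s \<omega> = 0"
  have "((\<lambda>t. X t \<omega>) \<longlongrightarrow> X t \<omega>) (at t within {0..})"
    using cont t by (auto simp: continuous_on_def)
  then have "\<forall>\<^sub>F s in at t within {0..}. X s \<omega> \<noteq> 0"
    using no t by (intro tendsto_imp_eventually_ne) auto
  then obtain d where d: "d > 0" "\<And>s. 0 \<le> s \<Longrightarrow> s \<noteq> t \<Longrightarrow> dist s t < d \<Longrightarrow> X s \<omega> \<noteq> 0"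
    unfolding eventually_at by auto
  have "t + d \<le> s" if "0 \<le> s" "X s \<omega> = 0" for s
  proof -
    have "t < s" using no that by (meson not_less)
    then show ?thesis using d(2)[OF that(1)] that(2) by (cases "s < t + d") (auto simp: dist_real_def)
  qed
  then have "ereal (t + d) \<le> hitting_zero X \<omega>"
    unfolding hitting_zero_def by (intro Inf_greatest) auto
  from this le have "ereal (t + d) \<le> ereal t" by (rule order_trans)
  then show False using d(1) by simp
qed

lemma hitting_zero_le: "0 \<le> s \<Longrightarrow> X s \<omega> = 0 \<Longrightarrow> hitting_zero X \<omega> \<le> ereal s"
  unfolding hitting_zero_def by (intro Inf_lower) auto

lemma pos_hitting_zero_le: "0 < s \<Longrightarrow> X s \<omega> = 0 \<Longrightarrow> pos_hitting_zero X \<omega> \<le> ereal s"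
  unfolding pos_hitting_zero_def by (intro Inf_lower) auto

lemma pos_hitting_zero_lessD: "pos_hitting_zero X \<omega> < a \<Longrightarrow> \<exists>s>0. X s \<omega> = 0 \<and> ereal s < a"
  unfolding pos_hitting_zero_def by (auto simp: Inf_less_iff)

context density_martingale
begin

text \<open>Rational times \<open>q\<close> give a single null set, while \<open>s\<close> may be
  any real: continuity lets rational times before \<open>q\<close> detect the zero at
  \<open>s\<close>.\<close>

lemma h_absorbed_at_rationals: "AE \<omega> in Q. \<forall>q\<in>\<rat> \<inter> {0..}. \<forall>s. 0 \<le> s \<and> s < q \<and> h s \<omega> = 0 \<longrightarrow> h q \<omega> = 0"
proof -
  have "AE \<omega> in Q. \<forall>q\<in>\<rat> \<inter> {0..}. touches_zero h q \<omega> \<longrightarrow> h q \<omega> = 0"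
  proof (rule AE_ball_countable')
    show "countable (\<rat> \<inter> {0::real..})" using countable_rat by (rule countable_Int1)
    show "AE \<omega> in Q. touches_zero h q \<omega> \<longrightarrow> h q \<omega> = 0" if "q \<in> \<rat> \<inter> {0..}" for q
      using that by (intro h_absorbed_at_zero) auto
  qed
  then show ?thesis
    using AE_continuous_paths(1)
  proof eventually_elim
    case (elim \<omega>)
    then show ?case
      using continuous_zero_imp_touches_zero[of h \<omega>] by (auto simp: continuous_paths_def)
  qed
qed

text \<open>Constancy of the P-mean of \<open>N\<close>, read under Q; \<open>h0\<close> ensures
  that the cut-off removes nothing at time 0.\<close>

lemma martingale_N_integral_eq:
  assumes N: "martingale P F N" and h0: "AE \<omega> in Q. 0 < h 0 \<omega>" and t: "0 \<le> t"
  shows "(\<integral>\<omega>\<in>{\<omega>. h t \<omega> \<noteq> 0}. f t \<omega> \<partial>Q) = (\<integral>\<omega>. f 0 \<omega> \<partial>Q)"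
proof -
  have N_eq: "(\<integral>\<omega>. N u \<omega> \<partial>P) = (\<integral>\<omega>\<in>{\<omega>. h u \<omega> \<noteq> 0}. f u \<omega> \<partial>Q)" if u: "0 \<le> u" for u
  proof -
    have "(\<integral>\<omega>. N u \<omega> \<partial>P) = (\<integral>\<omega>\<in>space P. N u \<omega> \<partial>P)"
      by (rule set_integral_space[symmetric, OF N_integrable[OF u]])
    also have "\<dots> = (\<integral>\<omega>\<in>space P \<inter> {\<omega>. h u \<omega> \<noteq> 0}. f u \<omega> \<partial>Q)"
      using u by (intro set_integral_N) (metis space_eq Q.space_F sets.top)+
    also have "\<dots> = (\<integral>\<omega>\<in>{\<omega>. h u \<omega> \<noteq> 0}. f u \<omega> \<partial>Q)"
      unfolding set_lebesgue_integral_def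
      by (intro Bochner_Integration.integral_cong) (auto simp: space_eq indicator_def)
    finally show ?thesis .
  qed
  have "(\<integral>\<omega>. N t \<omega> \<partial>P) = (\<integral>\<omega>. N 0 \<omega> \<partial>P)"
    by (rule P.martingale_integral_eq[OF N order_refl t])
  then have "(\<integral>\<omega>\<in>{\<omega>. h t \<omega> \<noteq> 0}. f t \<omega> \<partial>Q) = (\<integral>\<omega>\<in>{\<omega>. h 0 \<omega> \<noteq> 0}. f 0 \<omega> \<partial>Q)"
    using N_eq[OF t] N_eq[of 0] by simp
  also have "\<dots> = (\<integral>\<omega>. f 0 \<omega> \<partial>Q)"
    unfolding set_lebesgue_integral_def
  proof (rule integral_cong_AE)
    have [measurable]: "f 0 \<in> borel_measurable Q" "h 0 \<in> borel_measurable Q"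
      using Q.measurable_F_imp[OF f_adapted[of 0]] Q.measurable_F_imp[OF h_adapted[of 0]] by auto
    have "(\<lambda>\<omega>. if h 0 \<omega> \<noteq> 0 then f 0 \<omega> else 0) \<in> borel_measurable Q" by measurable
    then show "(\<lambda>\<omega>. indicat_real {\<omega>. h 0 \<omega> \<noteq> 0} \<omega> *\<^sub>R f 0 \<omega>) \<in> borel_measurable Q"
      by (rule measurable_cong[THEN iffD1, rotated]) (simp add: indicator_def)
    show "AE \<omega> in Q. indicat_real {\<omega>. h 0 \<omega> \<noteq> 0} \<omega> *\<^sub>R f 0 \<omega> = f 0 \<omega>"
      using h0 by eventually_elim (simp add: indicator_def)
    show "f 0 \<in> borel_measurable Q" by measurable
  qed
  finally show ?thesis .
qed

text \<open>The surviving probability of \<open>h\<close> tends to 0, and uniform integrability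
  forbids \<open>f\<close> to keep a fixed mass on events of vanishing probability.\<close>

lemma not_martingale_N_uniformly_integrable:
  assumes h0: "AE \<omega> in Q. 0 < h 0 \<omega>" and ui: "uniformly_integrable Q f"
    and f0: "(\<integral>\<omega>. f 0 \<omega> \<partial>Q) \<noteq> 0" and fin: "AE \<omega> in Q. pos_hitting_zero h \<omega> < \<infinity>"
  shows "\<not> martingale P F N"
proof
  assume N: "martingale P F N"
  \<comment> \<open>Half of the mass to be contradicted: the tail of \<open>f\<close> takes up less
    than \<open>e\<close>, so the truncated part would have to supply the rest.\<close>
  define e where "e = \<bar>\<integral>\<omega>. f 0 \<omega> \<partial>Q\<bar> / 2"
  have e: "0 < e" using f0 by (simp add: e_def)
  then obtain K where K: "\<And>t. 0 \<le> t \<Longrightarrow>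
      (\<integral>\<omega>. \<bar>f t \<omega>\<bar> * indicator {\<omega>. K < \<bar>f t \<omega>\<bar>} \<omega> \<partial>Q) < e"
    using ui[unfolded uniformly_integrable_def, THEN conjunct2, rule_format, OF e] by auto
  have [measurable]: "f (real n) \<in> borel_measurable Q" "h (real n) \<in> borel_measurable Q" for n
    by (rule Q.measurable_F_imp[OF f_adapted] Q.measurable_F_imp[OF h_adapted], simp)+
  define p where "p n = (\<integral>\<omega>. indicat_real {\<omega>\<in>space Q. h (real n) \<omega> \<noteq> 0} \<omega> \<partial>Q)" for n
  have p: "p \<longlonglongrightarrow> (\<integral>\<omega>. 0 \<partial>Q)"
    unfolding p_def
  proof (rule integral_dominated_convergence[where w="\<lambda>_. 1"])
    show "AE \<omega> in Q. (\<lambda>n. indicat_real {\<omega>\<in>space Q. h (real n) \<omega> \<noteq> 0} \<omega>) \<longlonglongrightarrow> 0"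
      using fin h_absorbed_at_rationals
    proof eventually_elim
      case (elim \<omega>)
      obtain s where s: "0 < s" "h s \<omega> = 0" using pos_hitting_zero_lessD[OF elim(1)] by auto
      obtain m :: nat where m: "s < m" using reals_Archimedean2 by blast
      have "h (real n) \<omega> = 0" if "m \<le> n" for n
      proof -
        have "real n \<in> \<rat> \<inter> {0..}" "s < real n" using m that by auto
        then show ?thesis using elim(2)[rule_format, of "real n" s] s by simp
      qed
      then have "\<forall>\<^sub>F n in sequentially. indicat_real {\<omega>\<in>space Q. h (real n) \<omega> \<noteq> 0} \<omega> = 0"
        unfolding eventually_sequentially by (intro exI[of _ m]) auto
      then show ?case by (rule tendsto_eventually)
    qed
  qed auto
  have bound: "2 * e \<le> e + max K 0 * p n" for n
  proof -
    have int: "integrable Q (f (real n))" by (rule f_integrable) simp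
    have ind: "integrable Q (indicat_real {\<omega>\<in>space Q. h (real n) \<omega> \<noteq> 0})"
      using Q.emeasure_finite by (intro integrable_real_indicator) (auto simp: less_top[symmetric])
    have int1: "integrable Q (\<lambda>\<omega>. \<bar>f (real n) \<omega>\<bar> * indicat_real {\<omega>. K < \<bar>f (real n) \<omega>\<bar>} \<omega>)"
    proof -
      have "integrable Q (\<lambda>\<omega>. indicat_real {\<omega>\<in>space Q. K < \<bar>f (real n) \<omega>\<bar>} \<omega> *\<^sub>R \<bar>f (real n) \<omega>\<bar>)"
        using int by (intro integrable_mult_indicator) auto
      then show ?thesis
        by (rule Bochner_Integration.integrable_cong[THEN iffD1, rotated 2]) (auto simp: indicator_def)
    qed
    have "2 * e = \<bar>\<integral>\<omega>\<in>{\<omega>. h (real n) \<omega> \<noteq> 0}. f (real n) \<omega> \<partial>Q\<bar>"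
      using martingale_N_integral_eq[OF N h0, of "real n"] by (simp add: e_def)
    also have "\<dots> \<le> (\<integral>\<omega>. \<bar>indicat_real {\<omega>. h (real n) \<omega> \<noteq> 0} \<omega> *\<^sub>R f (real n) \<omega>\<bar> \<partial>Q)"
      unfolding set_lebesgue_integral_def by (rule integral_abs_bound)
    \<comment> \<open>Values above \<open>K\<close> are charged to the tail; the others are at most
      \<open>K\<close> and count only where \<open>h\<close> is nonzero. \<open>max K 0\<close>
      covers a negative \<open>K\<close>.\<close>
    also have "\<dots> \<le> (\<integral>\<omega>. \<bar>f (real n) \<omega>\<bar> * indicat_real {\<omega>. K < \<bar>f (real n) \<omega>\<bar>} \<omega>
        + max K 0 * indicat_real {\<omega>\<in>space Q. h (real n) \<omega> \<noteq> 0} \<omega> \<partial>Q)"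
    proof (rule Bochner_Integration.integral_mono')
      show "integrable Q (\<lambda>\<omega>. \<bar>f (real n) \<omega>\<bar> * indicat_real {\<omega>. K < \<bar>f (real n) \<omega>\<bar>} \<omega>
        + max K 0 * indicat_real {\<omega>\<in>space Q. h (real n) \<omega> \<noteq> 0} \<omega>)"
        by (intro Bochner_Integration.integrable_add int1 integrable_mult_right ind)
    qed (auto simp: indicator_def)
    also have "\<dots> = (\<integral>\<omega>. \<bar>f (real n) \<omega>\<bar> * indicat_real {\<omega>. K < \<bar>f (real n) \<omega>\<bar>} \<omega> \<partial>Q) + max K 0 * p n"
      unfolding p_def using int1 ind by (subst Bochner_Integration.integral_add) auto
    also have "\<dots> \<le> e + max K 0 * p n" using K[of "real n"] by simp
    finally show ?thesis .
  qed
  have "(\<lambda>n. e + max K 0 * p n) \<longlonglongrightarrow> e + max K 0 * 0"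
    using p by (intro tendsto_intros) simp
  then have "2 * e \<le> e + max K 0 * 0"
    by (rule LIMSEQ_le_const) (use bound in blast)
  then show False using e by simp
qed

text \<open>The mean of \<open>f t\<close> then equals its part on \<open>h t \<noteq> 0\<close>, so
  the nonnegative part on \<open>h t = 0\<close> has integral 0.\<close>

lemma martingale_N_imp_zero:
  assumes N: "martingale P F N" and h0: "AE \<omega> in Q. 0 < h 0 \<omega>"
    and nn: "AE \<omega> in Q. 0 \<le> f t \<omega>" and t: "0 \<le> t"
  shows "AE \<omega> in Q. h t \<omega> = 0 \<longrightarrow> f t \<omega> = 0"
proof -
  have [measurable]: "f t \<in> borel_measurable Q" "h t \<in> borel_measurable Q"
    using Q.measurable_F_imp[OF f_adapted[OF t]] Q.measurable_F_imp[OF h_adapted[OF t]] by auto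
  let ?A = "{\<omega>\<in>space Q. h t \<omega> \<noteq> 0}" and ?Z = "{\<omega>\<in>space Q. h t \<omega> = 0}"
  have int: "integrable Q (\<lambda>\<omega>. indicat_real ?A \<omega> *\<^sub>R f t \<omega>)" "integrable Q (\<lambda>\<omega>. indicat_real ?Z \<omega> *\<^sub>R f t \<omega>)"
    using f_integrable[OF t] by (auto intro!: integrable_mult_indicator simp del: real_scaleR_def)
  have "(\<integral>\<omega>. indicat_real ?A \<omega> *\<^sub>R f t \<omega> \<partial>Q) = (\<integral>\<omega>\<in>{\<omega>. h t \<omega> \<noteq> 0}. f t \<omega> \<partial>Q)"
    unfolding set_lebesgue_integral_def
    by (intro Bochner_Integration.integral_cong) (auto simp: indicator_def)
  also have "\<dots> = (\<integral>\<omega>. f t \<omega> \<partial>Q)"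
    using martingale_N_integral_eq[OF N h0 t] Q.martingale_integral_eq[OF f_martingale order_refl t] by simp
  also have "\<dots> = (\<integral>\<omega>. indicat_real ?A \<omega> *\<^sub>R f t \<omega> + indicat_real ?Z \<omega> *\<^sub>R f t \<omega> \<partial>Q)"
    by (intro Bochner_Integration.integral_cong) (auto simp: indicator_def)
  also have "\<dots> = (\<integral>\<omega>. indicat_real ?A \<omega> *\<^sub>R f t \<omega> \<partial>Q) + (\<integral>\<omega>. indicat_real ?Z \<omega> *\<^sub>R f t \<omega> \<partial>Q)"
    by (rule Bochner_Integration.integral_add[OF int])
  finally have 0: "(\<integral>\<omega>. indicat_real ?Z \<omega> *\<^sub>R f t \<omega> \<partial>Q) = 0" by simp
  have "AE \<omega> in Q. 0 \<le> indicat_real ?Z \<omega> *\<^sub>R f t \<omega>"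
    using nn by eventually_elim simp
  then have "AE \<omega> in Q. indicat_real ?Z \<omega> *\<^sub>R f t \<omega> = 0"
    using integral_nonneg_eq_0_iff_AE[OF int(2)] 0 by simp
  then show ?thesis using AE_space by eventually_elim (auto simp: indicator_def)
qed

text \<open>On the event in question a rational \<open>q\<close> lies strictly between a zero of
  \<open>h\<close> and the first zero of \<open>f\<close>. Absorption gives \<open>h q = 0\<close>,
  and a martingale \<open>N\<close> would then force \<open>f q = 0\<close>.\<close>

lemma not_martingale_N_nonneg:
  assumes h0: "AE \<omega> in Q. 0 < h 0 \<omega>" and nn: "AE \<omega> in Q. \<forall>t\<ge>0. 0 \<le> f t \<omega>"
    and pos: "pos_prob Q (\<lambda>\<omega>. pos_hitting_zero h \<omega> < hitting_zero f \<omega>)"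
  shows "\<not> martingale P F N"
proof
  assume N: "martingale P F N"
  have "AE \<omega> in Q. \<forall>q\<in>\<rat> \<inter> {0..}. h q \<omega> = 0 \<longrightarrow> f q \<omega> = 0"
  proof (rule AE_ball_countable')
    show "countable (\<rat> \<inter> {0::real..})" using countable_rat by (rule countable_Int1)
    fix q :: real assume q: "q \<in> \<rat> \<inter> {0..}"
    then have "AE \<omega> in Q. 0 \<le> f q \<omega>" using nn by (auto elim: eventually_mono)
    then show "AE \<omega> in Q. h q \<omega> = 0 \<longrightarrow> f q \<omega> = 0"
      using q by (intro martingale_N_imp_zero[OF N h0]) auto
  qed
  then have "AE \<omega> in Q. \<not> pos_hitting_zero h \<omega> < hitting_zero f \<omega>"
    using h_absorbed_at_rationals
  proof eventually_elim
    case (elim \<omega>)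
    show ?case
    proof
      assume "pos_hitting_zero h \<omega> < hitting_zero f \<omega>"
      then obtain s where s: "0 < s" "h s \<omega> = 0" "ereal s < hitting_zero f \<omega>"
        by (auto dest: pos_hitting_zero_lessD)
      obtain r where "ereal s < ereal r" and r: "ereal r < hitting_zero f \<omega>"
        using ereal_dense2[OF s(3)] by blast
      then obtain q where q: "q \<in> \<rat>" "s < q" "q < r" using Rats_dense_in_real by auto
      then have "q \<in> \<rat> \<inter> {0..}" using s by auto
      then have "f q \<omega> = 0" using elim(1) elim(2)[rule_format, of q s] s q by simp
      then have "hitting_zero f \<omega> \<le> ereal q" using s q by (intro hitting_zero_le) auto
      then show False using r q by (metis ereal_less_eq(3) less_imp_le not_less order_trans)
    qed
  qed
  then show False using pos by (simp add: pos_prob_def)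
qed

lemma martingale_N:
  assumes nn: "AE \<omega> in Q. \<forall>t\<ge>0. 0 \<le> f t \<omega>"
    and before: "AE \<omega> in Q. \<not> pos_hitting_zero h \<omega> < hitting_zero f \<omega>"
  shows "martingale P F N"
proof -
  \<comment> \<open>Absorption is used twice: for \<open>h\<close>, to bound its hitting time by
    \<open>t\<close>, and for \<open>f\<close>, to carry a zero at some \<open>s < t\<close> forward
    to \<open>t\<close>.\<close>
  have zero: "AE \<omega> in Q. h t \<omega> = 0 \<longrightarrow> f t \<omega> = 0" if t: "0 \<le> t" for t
  proof -
    have "AE \<omega> in Q. 0 \<le> f t \<omega>" using nn by eventually_elim (use t in auto)
    then have "AE \<omega> in Q. touches_zero f t \<omega> \<longrightarrow> f t \<omega> = 0"
      by (rule Q.martingale_absorbed_at_zero[OF f_martingale _ t])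
    then show ?thesis
      using before h_absorbed_at_rationals AE_continuous_paths(1)
    proof eventually_elim
      case (elim \<omega>)
      note cont = elim(4)[unfolded continuous_paths_def]
      show ?case
      proof
        assume h: "h t \<omega> = 0"
        \<comment> \<open>The hitting time of \<open>h\<close> ignores time 0, so
          \<open>t = 0\<close> is not itself a candidate; rational zeros just after \<open>t\<close>
          give the bound up to an arbitrary \<open>d\<close>.\<close>
        have "pos_hitting_zero h \<omega> \<le> ereal t"
        proof (rule ereal_le_epsilon2)
          fix d :: real assume "0 < d"
          then obtain q where q: "q \<in> \<rat>" "t < q" "q < t + d" using Rats_dense_in_real[of t "t + d"] by auto
          then have "q \<in> \<rat> \<inter> {0..}" using t by auto
          then have "h q \<omega> = 0" using elim(3)[rule_format, of q t] h q t by simp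
          then have "pos_hitting_zero h \<omega> \<le> ereal q" using q t by (intro pos_hitting_zero_le) auto
          also have "\<dots> \<le> ereal t + ereal d" using q by simp
          finally show "pos_hitting_zero h \<omega> \<le> ereal t + ereal d" .
        qed
        then have "hitting_zero f \<omega> \<le> ereal t" using elim(2) by (auto simp: not_less)
        then obtain s where s: "0 \<le> s" "s \<le> t" "f s \<omega> = 0"
          using hitting_zero_le_imp_zero[of f \<omega> t] cont t by blast
        show "f t \<omega> = 0"
        proof (cases "s = t")
          case False
          then have "touches_zero f t \<omega>"
            using cont s by (intro continuous_zero_imp_touches_zero[of f \<omega> s]) auto
          then show ?thesis using elim(1) by blast
        qed (use s in simp)
      qed
    qed
  qed
  have eq: "(\<integral>\<omega>\<in>A. N t \<omega> \<partial>P) = (\<integral>\<omega>\<in>A. f t \<omega> \<partial>Q)" if t: "0 \<le> t" and A: "A \<in> sets (F t)" for t A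
  proof -
    have [measurable]: "f t \<in> borel_measurable Q" "h t \<in> borel_measurable Q" "A \<in> sets Q"
      using Q.measurable_F_imp[OF f_adapted[OF t]] Q.measurable_F_imp[OF h_adapted[OF t]] Q.sets_F_imp[OF A]
      by auto
    have "(\<integral>\<omega>\<in>A. N t \<omega> \<partial>P) = (\<integral>\<omega>\<in>A \<inter> {\<omega>. h t \<omega> \<noteq> 0}. f t \<omega> \<partial>Q)" by (rule set_integral_N[OF t A])
    also have "\<dots> = (\<integral>\<omega>\<in>A. f t \<omega> \<partial>Q)"
      unfolding set_lebesgue_integral_def
    proof (rule integral_cong_AE)
      have "(\<lambda>\<omega>. if h t \<omega> \<noteq> 0 then indicat_real A \<omega> * f t \<omega> else 0) \<in> borel_measurable Q" by measurable
      then show "(\<lambda>\<omega>. indicat_real (A \<inter> {\<omega>. h t \<omega> \<noteq> 0}) \<omega> *\<^sub>R f t \<omega>) \<in> borel_measurable Q"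
        by (rule measurable_cong[THEN iffD1, rotated]) (simp add: indicator_def)
      show "AE \<omega> in Q. indicat_real (A \<inter> {\<omega>. h t \<omega> \<noteq> 0}) \<omega> *\<^sub>R f t \<omega> = indicat_real A \<omega> *\<^sub>R f t \<omega>"
        using zero[OF t] by eventually_elim (auto simp: indicator_def)
    qed measurable
    finally show ?thesis .
  qed
  show ?thesis
    unfolding P.martingale_iff
  proof (intro conjI allI impI ballI N_adapted N_integrable)
    fix s t A assume st: "(0::real) \<le> s" "s \<le> t" and A: "A \<in> sets (F s)"
    have "A \<in> sets (F t)" using A Q.sets_F_mono[OF st(2)] by blast
    then have "(\<integral>\<omega>\<in>A. N t \<omega> \<partial>P) = (\<integral>\<omega>\<in>A. f t \<omega> \<partial>Q)" using st by (intro eq) auto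
    also have "\<dots> = (\<integral>\<omega>\<in>A. f s \<omega> \<partial>Q)" by (rule f_set_integral[OF st A])
    also have "\<dots> = (\<integral>\<omega>\<in>A. N s \<omega> \<partial>P)" by (rule eq[OF st(1) A, symmetric])
    finally show "(\<integral>\<omega>\<in>A. N t \<omega> \<partial>P) = (\<integral>\<omega>\<in>A. N s \<omega> \<partial>P)" .
  qed
qed

end

theorem proposition1:
  fixes P Q :: "'a measure"
    and F :: "real \<Rightarrow> 'a measure"
    and h f :: "real \<Rightarrow> 'a \<Rightarrow> real"
  defines "\<tau>\<^sub>0 \<equiv> pos_hitting_zero h"
    and "\<sigma>\<^sub>0 \<equiv> hitting_zero f"
    and "N \<equiv> (\<lambda>t \<omega>. f t \<omega> / h t \<omega>)"
  assumes "prob_space P" and "prob_space Q" and "sets P = sets Q"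
    and "filtration (space Q) F" and "\<forall>t\<ge>0. subalgebra Q (F t)"
    and "locally_abs_continuous P Q F"
    and "RN_process P Q F h"
    and "pos_prob Q (\<lambda>\<omega>. \<tau>\<^sub>0 \<omega> < \<infinity>)"
    and "as_continuous Q F h"
    and "martingale Q F f" and "as_continuous Q F f"
  shows "((AE \<omega> in Q. 0 < h 0 \<omega>) \<longrightarrow>
            (uniformly_integrable Q f \<and> (\<integral>\<omega>. f 0 \<omega> \<partial>Q) \<noteq> 0 \<and> (AE \<omega> in Q. \<tau>\<^sub>0 \<omega> < \<infinity>)) \<or>
            ((AE \<omega> in Q. \<forall>t\<ge>0. 0 \<le> f t \<omega>) \<and> pos_prob Q (\<lambda>\<omega>. \<tau>\<^sub>0 \<omega> < \<sigma>\<^sub>0 \<omega>)) \<longrightarrow>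
            strict_local_martingale P F N) \<and>
         ((AE \<omega> in Q. \<forall>t\<ge>0. 0 \<le> f t \<omega>) \<and> (AE \<omega> in Q. \<not> \<tau>\<^sub>0 \<omega> < \<sigma>\<^sub>0 \<omega>) \<longrightarrow>
            martingale P F N)"
proof -
  interpret Q: filtered_prob_space Q F
    by (intro filtered_prob_space.intro filtered_prob_space_axioms.intro) (use assms in auto)
  interpret D: density_martingale P Q F h f
    by (intro density_martingale.intro density_process.intro density_process_axioms.intro
        density_martingale_axioms.intro Q.filtered_prob_space_axioms) (fact assms)+
  have N: "N = D.N"
    by (intro ext) (simp add: N_def D.N_def)
  have "\<not> martingale P F D.N" if h0: "AE \<omega> in Q. 0 < h 0 \<omega>"
      and cond: "(uniformly_integrable Q f \<and> (\<integral>\<omega>. f 0 \<omega> \<partial>Q) \<noteq> 0 \<and> (AE \<omega> in Q. \<tau>\<^sub>0 \<omega> < \<infinity>)) \<or>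
       ((AE \<omega> in Q. \<forall>t\<ge>0. 0 \<le> f t \<omega>) \<and> pos_prob Q (\<lambda>\<omega>. \<tau>\<^sub>0 \<omega> < \<sigma>\<^sub>0 \<omega>))"
    using cond
  proof (elim disjE conjE)
    assume "uniformly_integrable Q f" "(\<integral>\<omega>. f 0 \<omega> \<partial>Q) \<noteq> 0" "AE \<omega> in Q. \<tau>\<^sub>0 \<omega> < \<infinity>"
    then show ?thesis
      unfolding \<tau>\<^sub>0_def by (rule D.not_martingale_N_uniformly_integrable[OF h0])
  next
    assume "AE \<omega> in Q. \<forall>t\<ge>0. 0 \<le> f t \<omega>" "pos_prob Q (\<lambda>\<omega>. \<tau>\<^sub>0 \<omega> < \<sigma>\<^sub>0 \<omega>)"
    then show ?thesis
      unfolding \<tau>\<^sub>0_def \<sigma>\<^sub>0_def by (rule D.not_martingale_N_nonneg[OF h0])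
  qed
  moreover have "martingale P F D.N" if "AE \<omega> in Q. \<forall>t\<ge>0. 0 \<le> f t \<omega>" "AE \<omega> in Q. \<not> \<tau>\<^sub>0 \<omega> < \<sigma>\<^sub>0 \<omega>"
    using that unfolding \<tau>\<^sub>0_def \<sigma>\<^sub>0_def by (rule D.martingale_N)
  ultimately show ?thesis
    unfolding N strict_local_martingale_def using D.N_local_martingale by (intro conjI impI) auto
qed

end
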